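(* Consider $\mathrm{BOHT}(T,q,r,\pi,B)$ for a fixed rooted $r$-uniform linear hypertree $T$. (i) If $\mathrm{br}(T)\,\eta^{(m,ht)}_{\mathrm{KL}}(\pi,B)<1$, or if $\mathrm{br}(T)\,\eta^{(m,ht)}_{\mathrm{SKL}}(\pi,B)<1$, $I_{\mathrm{SKL}}(\pi,B)<\infty$ and every vertex of $T$ has at most some fixed finite number of downward hyperedges, then reconstruction is impossible. (ii) Suppose the model is binary symmetric. If $\mathrm{br}(T)\,\eta^{(m,ht,s)}_{\mathrm{KL}}(B)<1$, or $\mathrm{br}(T)\,\eta^{(m,ht,s)}_{\chi^2}(B)<1$, or $\mathrm{br}(T)\,\eta^{(m,ht,s)}_{\mathrm{SKL}}(B)<1$ together with $C_{\mathrm{SKL}}(B)<\infty$ and every vertex of $T$ having at most some fixed finite number of downward hyperedges, then reconstruction is impossible.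
   Context: Let $q\ge2$, $r\ge2$, $\pi$ a full-support distribution on $[q]$, and $B:[q]\to[q]^{r-1}$ a kernel with $\sum_k\pi_k\sum_{x:\,x_i=j}B(x|k)=\pi_j$ for all $i\in[r-1]$, $j\in[q]$. For an $r$-uniform linear hypertree $T$ rooted at $\rho$ (each vertex $u$ has a set of downward hyperedges $\{u,v_1,\dots,v_{r-1}\}$ whose other vertices are children of $u$), $\mathrm{BOHT}(T,q,r,\pi,B)$ draws $\sigma_\rho\sim\pi$ and, given $\sigma_u$, independently for each downward hyperedge draws the children's labels from $B(\cdot|\sigma_u)$. With $L_k$ the vertices at distance $k$ from $\rho$, reconstruction is impossible if $\lim_k I(\sigma_\rho;\sigma_{L_k})=0$. Branching number: for a rooted tree, a flow is $f:V\to\mathbb R_{\ge0}$ with $f_u=\sum_{v\text{ child of }u}f_v$ for all $u$; $\mathrm{br}(T)$ is the supremum of $\lambda$ such that some flow has $f_\rho>0$ and $f_u\le\lambda^{-\mathrm{depth}(u)}$ for all $u$. For a hypertree, $\mathrm{br}(T)$ is the branching number of the tree obtained by replacing each downward hyperedge $\{u,v_1,\dots,v_{r-1}\}$ by the $r-1$ edges $uv_i$. $I_f(\pi,P)$ is the $f$-information $D_f(P_{XY}\|P_X\otimes P_Y)$ for $X\sim\pi$, $Y|X\sim P$ (KL: $f=x\log x$; $\chi^2$: $(x-1)^2$; SKL: $(x-1)\log x$). Heterogeneous multi-terminal coefficient: $\eta^{(m,ht)}_f(\pi,B)=\sup\frac{I_f(\pi,(P_1\times\cdots\times P_{r-1})\circ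 B)}{\sum_iI_f(\pi,P_i)}$ over channels $P_1,\dots,P_{r-1}$ with input $[q]$ and $0<\sum_iI_f(\pi,P_i)<\infty$, where $\times$ is the tensor product of channels. BMS channel: $P:\{\pm\}\to\mathcal Y$ with a measurable involution $\sigma$ of $\mathcal Y$ such that $P(E|+)=P(\sigma(E)|-)$. The model is binary symmetric if $q=2$, $\pi=\mathrm{Unif}(\{\pm\})$ and $B$ with the coordinatewise sign flip is BMS. $C_f(P)=I_f(\mathrm{Unif}(\{\pm\}),P)$; $\eta^{(m,ht,s)}_f(B)$ is defined as $\eta^{(m,ht)}_f$ but with supremum over BMS $P_1,\dots,P_{r-1}$ and $C_f$ in place of $I_f$.
   Formalization: The hypertree T is additionally assumed locally finite (each vertex has finitely many downward hyperedges); without this the claim fails, e.g. for a root with infinitely many infinite rays (br = 1) and a binary symmetric channel. *)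

theory Defs
  imports "HOL-Probability.Probability"
begin

text \<open>Labels are [q] = {0..<q}. Configurations of the r-1 children of a hyperedge are
  extensional functions {0..<r-1} -> [q].\<close>

definition cfgs :: "nat \<Rightarrow> nat \<Rightarrow> (nat \<Rightarrow> nat) set" where
  "cfgs r q = PiE {0..<r-1} (\<lambda>_. {0..<q})"

definition boht_params :: "nat \<Rightarrow> nat \<Rightarrow> (nat \<Rightarrow> real) \<Rightarrow> (nat \<Rightarrow> (nat \<Rightarrow> nat) \<Rightarrow> real) \<Rightarrow> bool" where
  "boht_params q r \<pi> B \<longleftrightarrow> 2 \<le> q \<and> 2 \<le> r \<and>
     (\<forall>a<q. 0 < \<pi> a) \<and> (\<Sum>a<q. \<pi> a) = 1 \<and>
     (\<forall>a<q. (\<forall>x\<in>cfgs r q. 0 \<le> B a x) \<and> (\<Sum>x\<in>cfgs r q. B a x) = 1) \<and>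
     (\<forall>i<r-1. \<forall>j<q. (\<Sum>k<q. \<pi> k * (\<Sum>x\<in>{x\<in>cfgs r q. x i = j}. B k x)) = \<pi> j)"

definition Bmeas :: "nat \<Rightarrow> nat \<Rightarrow> (nat \<Rightarrow> (nat \<Rightarrow> nat) \<Rightarrow> real) \<Rightarrow> nat \<Rightarrow> (nat \<Rightarrow> nat) measure" where
  "Bmeas q r B = (\<lambda>a. point_measure (cfgs r q) (\<lambda>x. ennreal (B a x)))"

definition channel :: "nat \<Rightarrow> (nat \<Rightarrow> 'b measure) \<Rightarrow> bool" where
  "channel q P \<longleftrightarrow> (\<forall>a<q. prob_space (P a) \<and> sets (P a) = sets (P 0))"

definition mixture :: "nat \<Rightarrow> (nat \<Rightarrow> real) \<Rightarrow> (nat \<Rightarrow> 'b measure) \<Rightarrow> 'b measure" where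
  "mixture q \<pi> P = bind (point_measure {0..<q} (\<lambda>a. ennreal (\<pi> a))) P"

text \<open>f-information D_f(P_XY || P_X x P_Y) for finite X ~ pi, written out as
  sum_a pi_a * int f(dP(.|a)/dP_Y) dP_Y.  The generator f is given in a nonnegative
  normalised form (see below), valued in [0,infinity].\<close>

definition f_info :: "(real \<Rightarrow> ennreal) \<Rightarrow> nat \<Rightarrow> (nat \<Rightarrow> real) \<Rightarrow> (nat \<Rightarrow> 'b measure) \<Rightarrow> ennreal" where
  "f_info f q \<pi> P = (\<Sum>a<q. ennreal (\<pi> a) *
      (\<integral>\<^sup>+ y. f (enn2real (RN_deriv (mixture q \<pi> P) (P a) y)) \<partial>(mixture q \<pi> P)))"

text \<open>Generators: KL (x log x, normalised to x log x - x + 1), chi^2 ((x-1)^2),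
  SKL ((x-1) log x, with value infinity at 0, its limit).\<close>

definition f_KL :: "real \<Rightarrow> ennreal" where
  "f_KL t = ennreal (t * ln t - t + 1)"

definition f_chi2 :: "real \<Rightarrow> ennreal" where
  "f_chi2 t = ennreal ((t - 1)^2)"

definition f_SKL :: "real \<Rightarrow> ennreal" where
  "f_SKL t = (if t = 0 then \<infinity> else ennreal ((t - 1) * ln t))"

definition compose_B :: "nat \<Rightarrow> nat \<Rightarrow> (nat \<Rightarrow> (nat \<Rightarrow> nat) \<Rightarrow> real) \<Rightarrow>
    (nat \<Rightarrow> nat \<Rightarrow> 'b measure) \<Rightarrow> nat \<Rightarrow> (nat \<Rightarrow> 'b) measure" where
  "compose_B r q B Ps a = bind (point_measure (cfgs r q) (\<lambda>x. ennreal (B a x)))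
      (\<lambda>x. PiM {0..<r-1} (\<lambda>i. Ps i (x i)))"

definition eta_ht :: "(real \<Rightarrow> ennreal) \<Rightarrow> nat \<Rightarrow> nat \<Rightarrow> (nat \<Rightarrow> real) \<Rightarrow>
    (nat \<Rightarrow> (nat \<Rightarrow> nat) \<Rightarrow> real) \<Rightarrow> ennreal" where
  "eta_ht f q r \<pi> B =
     (SUP Ps \<in> {Ps :: nat \<Rightarrow> nat \<Rightarrow> real measure.
                 (\<forall>i<r-1. channel q (Ps i)) \<and>
                 0 < (\<Sum>i<r-1. f_info f q \<pi> (Ps i)) \<and> (\<Sum>i<r-1. f_info f q \<pi> (Ps i)) < \<infinity>}.
        f_info f q \<pi> (compose_B r q B Ps) / (\<Sum>i<r-1. f_info f q \<pi> (Ps i)))"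

text \<open>Label 0 plays the role of +, label 1 of -.\<close>

definition bms_inv :: "(nat \<Rightarrow> 'b measure) \<Rightarrow> ('b \<Rightarrow> 'b) \<Rightarrow> bool" where
  "bms_inv P s \<longleftrightarrow> channel 2 P \<and> s \<in> measurable (P 0) (P 0) \<and>
     (\<forall>y\<in>space (P 0). s (s y) = y) \<and>
     (\<forall>E\<in>sets (P 0). emeasure (P 0) E = emeasure (P 1) (s ` E))"

definition bms :: "(nat \<Rightarrow> 'b measure) \<Rightarrow> bool" where
  "bms P \<longleftrightarrow> (\<exists>s. bms_inv P s)"

definition C_f :: "(real \<Rightarrow> ennreal) \<Rightarrow> (nat \<Rightarrow> 'b measure) \<Rightarrow> ennreal" where
  "C_f f P = f_info f 2 (\<lambda>_. 1/2) P"

definition eta_hts :: "(real \<Rightarrow> ennreal) \<Rightarrow> nat \<Rightarrow> (nat \<Rightarrow> (nat \<Rightarrow> nat) \<Rightarrow> real) \<Rightarrow> ennreal" where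
  "eta_hts f r B =
     (SUP Ps \<in> {Ps :: nat \<Rightarrow> nat \<Rightarrow> real measure.
                 (\<forall>i<r-1. bms (Ps i)) \<and>
                 0 < (\<Sum>i<r-1. C_f f (Ps i)) \<and> (\<Sum>i<r-1. C_f f (Ps i)) < \<infinity>}.
        C_f f (compose_B r 2 B Ps) / (\<Sum>i<r-1. C_f f (Ps i)))"

definition flip :: "nat \<Rightarrow> (nat \<Rightarrow> nat) \<Rightarrow> (nat \<Rightarrow> nat)" where
  "flip r x = restrict (\<lambda>i. 1 - x i) {0..<r-1}"

definition binary_symmetric :: "nat \<Rightarrow> nat \<Rightarrow> (nat \<Rightarrow> real) \<Rightarrow> (nat \<Rightarrow> (nat \<Rightarrow> nat) \<Rightarrow> real) \<Rightarrow> bool" where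
  "binary_symmetric q r \<pi> B \<longleftrightarrow> q = 2 \<and> \<pi> 0 = 1/2 \<and> \<pi> 1 = 1/2 \<and> bms_inv (Bmeas 2 r B) (flip r)"

text \<open>A vertex is the path from the root: a list of (hyperedge index, position in
  hyperedge). Vertex u@[(e,i)] is the i-th child (i < r-1) in the e-th downward
  hyperedge of u.  Hypertrees are locally finite.\<close>

type_synonym vtx = "(nat \<times> nat) list"

definition down_edges :: "vtx set \<Rightarrow> vtx \<Rightarrow> nat set" where
  "down_edges V u = {e. u @ [(e, 0)] \<in> V}"

definition hypertree :: "nat \<Rightarrow> vtx set \<Rightarrow> bool" where
  "hypertree r V \<longleftrightarrow> [] \<in> V \<and> (\<forall>u c. u @ [c] \<in> V \<longrightarrow> u \<in> V) \<and>
     (\<forall>u e i. u @ [(e, i)] \<in> V \<longrightarrow> i < r - 1 \<and> (\<forall>j<r-1. u @ [(e, j)] \<in> V)) \<and>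
     (\<forall>u\<in>V. finite (down_edges V u))"

definition children :: "vtx set \<Rightarrow> vtx \<Rightarrow> vtx set" where
  "children V u = {v\<in>V. \<exists>c. v = u @ [c]}"

definition level :: "vtx set \<Rightarrow> nat \<Rightarrow> vtx set" where
  "level V k = {u\<in>V. length u = k}"

definition is_flow :: "vtx set \<Rightarrow> (vtx \<Rightarrow> real) \<Rightarrow> bool" where
  "is_flow V f \<longleftrightarrow> (\<forall>u\<in>V. 0 \<le> f u \<and> f u = (\<Sum>v\<in>children V u. f v))"

definition br :: "vtx set \<Rightarrow> ennreal" where
  "br V = (SUP l \<in> {l::real. 0 < l \<and> (\<exists>f. is_flow V f \<and> 0 < f [] \<and>
                        (\<forall>u\<in>V. f u \<le> (1 / l) ^ length u))}. ennreal l)"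

text \<open>lawbelow ... k u a x = probability that the vertices at relative depth k below u
  receive the labels x, given sigma_u = a.\<close>

primrec lawbelow :: "vtx set \<Rightarrow> nat \<Rightarrow> nat \<Rightarrow> (nat \<Rightarrow> (nat \<Rightarrow> nat) \<Rightarrow> real) \<Rightarrow>
    nat \<Rightarrow> vtx \<Rightarrow> nat \<Rightarrow> (vtx \<Rightarrow> nat) \<Rightarrow> real" where
  "lawbelow V r q B 0 u a x = (if x u = a then 1 else 0)"
| "lawbelow V r q B (Suc k) u a x =
     (\<Prod>e\<in>down_edges V u. \<Sum>y\<in>cfgs r q. B a y * (\<Prod>i<r-1. lawbelow V r q B k (u @ [(e, i)]) (y i) x))"

definition joint :: "vtx set \<Rightarrow> nat \<Rightarrow> nat \<Rightarrow> (nat \<Rightarrow> real) \<Rightarrow> (nat \<Rightarrow> (nat \<Rightarrow> nat) \<Rightarrow> real) \<Rightarrow>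
    nat \<Rightarrow> nat \<Rightarrow> (vtx \<Rightarrow> nat) \<Rightarrow> real" where
  "joint V r q \<pi> B k a x = \<pi> a * lawbelow V r q B k [] a x"

text \<open>I(sigma_rho; sigma_{L_k}) (natural log, 0 log 0 = 0).\<close>

definition mutual_info_level :: "vtx set \<Rightarrow> nat \<Rightarrow> nat \<Rightarrow> (nat \<Rightarrow> real) \<Rightarrow>
    (nat \<Rightarrow> (nat \<Rightarrow> nat) \<Rightarrow> real) \<Rightarrow> nat \<Rightarrow> real" where
  "mutual_info_level V r q \<pi> B k =
     (\<Sum>a<q. \<Sum>x\<in>PiE (level V k) (\<lambda>_. {0..<q}).
        joint V r q \<pi> B k a x *
        ln (joint V r q \<pi> B k a x / (\<pi> a * (\<Sum>b<q. joint V r q \<pi> B k b x))))"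

definition recon_impossible :: "vtx set \<Rightarrow> nat \<Rightarrow> nat \<Rightarrow> (nat \<Rightarrow> real) \<Rightarrow>
    (nat \<Rightarrow> (nat \<Rightarrow> nat) \<Rightarrow> real) \<Rightarrow> bool" where
  "recon_impossible V r q \<pi> B \<longleftrightarrow> (\<lambda>k. mutual_info_level V r q \<pi> B k) \<longlonglongrightarrow> 0"

definition bounded_down_degree :: "vtx set \<Rightarrow> bool" where
  "bounded_down_degree V \<longleftrightarrow> (\<exists>D::nat. \<forall>u\<in>V. card (down_edges V u) \<le> D)"

end

theory Submission
  imports Defs
begin

text \<open>
  Let \<open>I\<^sub>k(u)\<close> be the \<open>f\<close>-information between the label of \<open>u\<close> and the labels \<open>k\<close> levels below it.
  Given the label of \<open>u\<close> the downward hyperedges are independent, and \<open>f\<close>-information is subadditive over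
  conditionally independent observations (always for KL and SKL, for symmetric channels in the case of
  \<open>\<chi>\<^sup>2\<close>). Hence \<open>I\<^sub>k\<^sub>+\<^sub>1(u) \<le> \<eta> \<Sum>\<^sub>v I\<^sub>k(v)\<close>, the sum being over the children of \<open>u\<close>, and \<open>I\<^sub>k\<close> is uniformly bounded.
  So \<open>\<eta>^|u| I\<^sub>k(u)\<close> is at most a constant times the maximal flow through \<open>u\<close> under the capacities \<open>\<eta>^|v|\<close>,
  cut off at level \<open>k\<close>. As \<open>k\<close> grows these cut-off flows decrease to a function from which a genuine flow can
  be built unless it vanishes at the root; a genuine flow would give \<open>br(T) \<ge> 1/\<eta>\<close>.
\<close>

section \<open>Information of channels with finite output\<close>

text \<open>Every channel on the tree is finite, so the argument runs on the finite sum
  \<open>dinfo\<close>; measures enter only where the given definitions demand them. The supremum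
  defining \<eta> skips vanishing and infinite denominators. Channels of information zero are
  treated apart: they ignore their input. Infinite information forces the recursion to start one
  level down, since seeing the label itself has infinite SKL information. Likelihood ratios against
  the mixture are at most \<open>1 / \<pi> a\<close>, which bounds KL and chi-squared on every tree.
  SKL also needs ratios bounded below: finite information of \<open>B\<close> gives a ratio bound
  per hyperedge, and the degree bound controls the number of hyperedges. All generators dominate the
  KL one, so convergence of any of the informations suffices. No max-flow min-cut theorem enters:
  the limit \<open>L\<close> of the cut-off flows satisfies
  \<open>L u = min (t ^ length u) (\<Sum>v\<in>children V u. L v)\<close>, and splitting in
  proportion to \<open>L\<close> at each vertex gives a genuine flow. As \<eta> may be infinite, a
  separate case uses that \<open>br V = 0\<close> forces finite depth.\<close>

definition prior :: "nat \<Rightarrow> (nat \<Rightarrow> real) \<Rightarrow> bool" where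
  "prior q \<pi> \<longleftrightarrow> (\<forall>a<q. 0 < \<pi> a) \<and> (\<Sum>a<q. \<pi> a) = 1"

definition fchan :: "nat \<Rightarrow> 'b set \<Rightarrow> (nat \<Rightarrow> 'b \<Rightarrow> real) \<Rightarrow> bool" where
  "fchan q Y W \<longleftrightarrow> finite Y \<and> (\<forall>a<q. (\<forall>y\<in>Y. 0 \<le> W a y) \<and> (\<Sum>y\<in>Y. W a y) = 1)"

definition mix :: "nat \<Rightarrow> (nat \<Rightarrow> real) \<Rightarrow> (nat \<Rightarrow> 'b \<Rightarrow> real) \<Rightarrow> 'b \<Rightarrow> real" where
  "mix q \<pi> W y = (\<Sum>a<q. \<pi> a * W a y)"

text \<open>Where the mixture vanishes the quotient is \<open>0\<close> by convention, and the
  weight \<open>0\<close> cancels even \<open>f_SKL 0 = \<infinity>\<close>, because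
  \<open>0 * \<infinity> = 0\<close> in \<open>ennreal\<close>.\<close>

definition dinfo :: "(real \<Rightarrow> ennreal) \<Rightarrow> nat \<Rightarrow> (nat \<Rightarrow> real) \<Rightarrow> 'b set \<Rightarrow> (nat \<Rightarrow> 'b \<Rightarrow> real) \<Rightarrow> ennreal" where
  "dinfo f q \<pi> Y W =
     (\<Sum>a<q. ennreal (\<pi> a) * (\<Sum>y\<in>Y. ennreal (mix q \<pi> W y) * f (W a y / mix q \<pi> W y)))"

lemma fchanD:
  assumes "fchan q Y W"
  shows "finite Y" "\<And>a y. a < q \<Longrightarrow> y \<in> Y \<Longrightarrow> 0 \<le> W a y" "\<And>a. a < q \<Longrightarrow> (\<Sum>y\<in>Y. W a y) = 1"
  using assms by (auto simp: fchan_def)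

lemma priorD:
  assumes "prior q \<pi>"
  shows "\<And>a. a < q \<Longrightarrow> 0 < \<pi> a" "\<And>a. a < q \<Longrightarrow> 0 \<le> \<pi> a" "(\<Sum>a<q. \<pi> a) = 1"
  using assms by (auto simp: prior_def less_imp_le)

lemma mix_nonneg:
  assumes "prior q \<pi>" "fchan q Y W" "y \<in> Y"
  shows "0 \<le> mix q \<pi> W y"
  unfolding mix_def using assms
  by (intro sum_nonneg mult_nonneg_nonneg) (auto simp: fchan_def prior_def less_imp_le)

lemma mix_ge:
  assumes "prior q \<pi>" "fchan q Y W" "y \<in> Y" "a < q"
  shows "\<pi> a * W a y \<le> mix q \<pi> W y"
  unfolding mix_def using assms
  by (intro member_le_sum) (auto simp: fchan_def prior_def less_imp_le)

text \<open>Full support of the prior makes every row absolutely continuous with respect to the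
  mixture, which justifies the divisions by the mixture below.\<close>

lemma mix_zero_iff:
  assumes "prior q \<pi>" "fchan q Y W" "y \<in> Y"
  shows "mix q \<pi> W y = 0 \<longleftrightarrow> (\<forall>a<q. W a y = 0)"
proof -
  have "mix q \<pi> W y = 0 \<longleftrightarrow> (\<forall>a\<in>{..<q}. \<pi> a * W a y = 0)"
    unfolding mix_def using priorD(2)[OF assms(1)] fchanD(2)[OF assms(2) _ assms(3)]
    by (intro sum_nonneg_eq_0_iff) auto
  then show ?thesis using priorD(1)[OF assms(1)] by force
qed

lemma sum_mix:
  assumes "prior q \<pi>" "fchan q Y W"
  shows "(\<Sum>y\<in>Y. mix q \<pi> W y) = 1"
proof -
  have "(\<Sum>y\<in>Y. mix q \<pi> W y) = (\<Sum>a<q. \<pi> a * (\<Sum>y\<in>Y. W a y))"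
    unfolding mix_def by (subst sum.swap) (simp add: sum_distrib_left)
  also have "\<dots> = 1" using fchanD(3)[OF assms(2)] priorD(3)[OF assms(1)] by simp
  finally show ?thesis .
qed

text \<open>The real generator \<open>g\<close> has to match \<open>f\<close> only where the mixture
  is positive. This gives access to the real formula for SKL although \<open>f_SKL\<close> is
  infinite at \<open>0\<close>.\<close>

lemma dinfo_real:
  assumes "prior q \<pi>" "fchan q Y W"
    and "\<And>a y. a < q \<Longrightarrow> y \<in> Y \<Longrightarrow> 0 < mix q \<pi> W y \<Longrightarrow>
           f (W a y / mix q \<pi> W y) = ennreal (g (W a y / mix q \<pi> W y)) \<and> 0 \<le> g (W a y / mix q \<pi> W y)"
  shows "dinfo f q \<pi> Y W =
    ennreal (\<Sum>a<q. \<pi> a * (\<Sum>y\<in>Y. mix q \<pi> W y * g (W a y / mix q \<pi> W y)))"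
    and "0 \<le> (\<Sum>a<q. \<pi> a * (\<Sum>y\<in>Y. mix q \<pi> W y * g (W a y / mix q \<pi> W y)))"
proof -
  have nn: "0 \<le> mix q \<pi> W y * g (W a y / mix q \<pi> W y)" if "a < q" "y \<in> Y" for a y
    using assms(3)[OF that] mix_nonneg[OF assms(1,2) that(2)]
    by (cases "mix q \<pi> W y = 0") (auto intro: mult_nonneg_nonneg)
  have eq: "ennreal (mix q \<pi> W y) * f (W a y / mix q \<pi> W y) =
      ennreal (mix q \<pi> W y * g (W a y / mix q \<pi> W y))" if "a < q" "y \<in> Y" for a y
    using assms(3)[OF that] mix_nonneg[OF assms(1,2) that(2)]
    by (cases "mix q \<pi> W y = 0") (auto simp: ennreal_mult)
  have nn2: "0 \<le> (\<Sum>y\<in>Y. mix q \<pi> W y * g (W a y / mix q \<pi> W y))" if "a < q" for a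
    using nn[OF that] by (intro sum_nonneg) auto
  have "dinfo f q \<pi> Y W = (\<Sum>a<q. ennreal (\<pi> a) * (\<Sum>y\<in>Y. ennreal (mix q \<pi> W y * g (W a y / mix q \<pi> W y))))"
    unfolding dinfo_def by (intro sum.cong refl arg_cong2[where f="(*)"]) (auto simp: eq)
  also have "\<dots> = (\<Sum>a<q. ennreal (\<pi> a * (\<Sum>y\<in>Y. mix q \<pi> W y * g (W a y / mix q \<pi> W y))))"
    using nn priorD(2)[OF assms(1)]
    by (intro sum.cong refl) (auto simp: sum_ennreal sum_nonneg ennreal_mult)
  also have "\<dots> = ennreal (\<Sum>a<q. \<pi> a * (\<Sum>y\<in>Y. mix q \<pi> W y * g (W a y / mix q \<pi> W y)))"
    using nn2 priorD(2)[OF assms(1)] by (intro sum_ennreal mult_nonneg_nonneg) auto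
  finally show "dinfo f q \<pi> Y W = \<dots>" .
  show "0 \<le> (\<Sum>a<q. \<pi> a * (\<Sum>y\<in>Y. mix q \<pi> W y * g (W a y / mix q \<pi> W y)))"
    using nn2 priorD(2)[OF assms(1)] by (intro sum_nonneg mult_nonneg_nonneg[OF _ nn2]) auto
qed

lemma dinfo_reindex:
  assumes "bij_betw g Y Y'" "\<And>a y. a < q \<Longrightarrow> y \<in> Y \<Longrightarrow> W a y = W' a (g y)"
  shows "dinfo f q \<pi> Y W = dinfo f q \<pi> Y' W'"
proof -
  have m: "mix q \<pi> W y = mix q \<pi> W' (g y)" if "y \<in> Y" for y
    using that assms(2) by (simp add: mix_def)
  have "(\<Sum>y\<in>Y. ennreal (mix q \<pi> W y) * f (W a y / mix q \<pi> W y)) =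
      (\<Sum>y\<in>Y'. ennreal (mix q \<pi> W' y) * f (W' a y / mix q \<pi> W' y))" if "a < q" for a
    using assms(2)[OF that] m
    by (subst sum.reindex_bij_betw[OF assms(1), symmetric]) (auto intro: sum.cong)
  then show ?thesis unfolding dinfo_def by simp
qed

lemma fchan_reindex:
  assumes "bij_betw g Y Y'" "\<And>a y. a < q \<Longrightarrow> y \<in> Y \<Longrightarrow> W a y = W' a (g y)" "fchan q Y' W'"
  shows "fchan q Y W"
proof -
  have "(\<Sum>y\<in>Y. W a y) = (\<Sum>y\<in>Y'. W' a y)" if "a < q" for a
    using that assms(2) sum.reindex_bij_betw[OF assms(1), of "W' a"] by simp
  moreover have "g y \<in> Y'" if "y \<in> Y" for y using assms(1) that by (auto simp: bij_betw_def)
  ultimately show ?thesis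
    using assms bij_betw_finite[OF assms(1)] by (auto simp: fchan_def)
qed

lemma dinfo_mono:
  assumes "prior q \<pi>" "fchan q Y W" "\<And>t. 0 \<le> t \<Longrightarrow> f t \<le> g t"
  shows "dinfo f q \<pi> Y W \<le> dinfo g q \<pi> Y W"
  unfolding dinfo_def
  using mix_nonneg[OF assms(1,2)] fchanD(2)[OF assms(2)]
  by (intro sum_mono mult_left_mono assms(3) divide_nonneg_nonneg zero_le) auto

lemma dinfo_le_const:
  assumes "prior q \<pi>" "fchan q Y W"
    and "\<And>a y. a < q \<Longrightarrow> y \<in> Y \<Longrightarrow> 0 < mix q \<pi> W y \<Longrightarrow> f (W a y / mix q \<pi> W y) \<le> ennreal c" "0 \<le> c"
  shows "dinfo f q \<pi> Y W \<le> ennreal c"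
proof -
  have "dinfo f q \<pi> Y W \<le> dinfo (\<lambda>_. ennreal c) q \<pi> Y W"
  proof -
    have "ennreal (mix q \<pi> W y) * f (W a y / mix q \<pi> W y) \<le> ennreal (mix q \<pi> W y) * ennreal c"
      if "a < q" "y \<in> Y" for a y
      using mix_nonneg[OF assms(1,2), of y] assms(3)[of a y] that
      by (cases "mix q \<pi> W y = 0") (auto intro: mult_left_mono)
    then have "(\<Sum>y\<in>Y. ennreal (mix q \<pi> W y) * f (W a y / mix q \<pi> W y)) \<le> (\<Sum>y\<in>Y. ennreal (mix q \<pi> W y) * ennreal c)"
      if "a < q" for a
      using that by (intro sum_mono) auto
    then show ?thesis unfolding dinfo_def
      by (rule_tac sum_mono, rule_tac mult_left_mono) auto
  qed
  also have "\<dots> = ennreal (\<Sum>a<q. \<pi> a * (\<Sum>y\<in>Y. mix q \<pi> W y * c))"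
    using dinfo_real(1)[OF assms(1,2), of "\<lambda>_. ennreal c" "\<lambda>_. c"] assms(4) by simp
  also have "\<dots> = ennreal c"
    using sum_mix[OF assms(1,2)] priorD(3)[OF assms(1)]
    by (simp flip: sum_distrib_right)
  finally show ?thesis .
qed

section \<open>Comparison of the generators, and channels of information zero\<close>

text \<open>Follows from \<open>ln t \<le> t - 1\<close>. It carries the chi-squared bound over to
  KL and, like its SKL analogue, lets the limit be read off for KL.\<close>

lemma f_KL_le_f_chi2: "0 \<le> t \<Longrightarrow> f_KL t \<le> f_chi2 t"
proof -
  assume "0 \<le> t"
  have "t * ln t \<le> t * (t - 1)" using \<open>0 \<le> t\<close> ln_le_minus_one[of t]
    by (cases "t = 0") (auto intro: mult_left_mono)
  then show ?thesis unfolding f_KL_def f_chi2_def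
    by (intro ennreal_leI) (simp add: power2_eq_square algebra_simps)
qed

text \<open>For positive \<open>t\<close> the two sides differ by
  \<open>t - 1 - ln t\<close>.\<close>

lemma f_KL_le_f_SKL: "0 \<le> t \<Longrightarrow> f_KL t \<le> f_SKL t"
  unfolding f_KL_def f_SKL_def using ln_le_minus_one[of t]
  by (auto intro!: ennreal_leI simp: algebra_simps)

lemma x_ln_x_ge: "0 \<le> t \<Longrightarrow> (0::real) \<le> t * ln t - t + 1"
proof (cases "t = 0")
  case False
  assume "0 \<le> t"
  with False have "0 < t" by simp
  then have "- ln t \<le> 1 / t - 1" using ln_le_minus_one[of "1/t"] by (simp add: ln_div)
  then have "t * (- ln t) \<le> t * (1 / t - 1)" using \<open>0 < t\<close> by (intro mult_left_mono) auto
  then show ?thesis using \<open>0 < t\<close> by (simp add: algebra_simps)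
qed auto

text \<open>Equality case of \<open>ln x \<le> x - 1\<close>, taken at
  \<open>x = 1 / t\<close>.\<close>

lemma f_KL_eq_0D:
  assumes "0 \<le> t" "f_KL t = 0"
  shows "t = 1"
proof (cases "t = 0")
  case False
  with assms have "0 < t" "t * ln t - t + 1 = 0"
    using x_ln_x_ge[of t] by (auto simp: f_KL_def ennreal_eq_0_iff)
  then have "ln (1/t) = 1/t - 1" by (simp add: ln_div field_simps)
  then show ?thesis using ln_eq_minus_one[of "1/t"] \<open>0 < t\<close> by simp
qed (use assms in \<open>auto simp: f_KL_def\<close>)

text \<open>Domination of \<open>f_KL\<close> reduces every generator to the fact that
  \<open>f_KL\<close> vanishes only at \<open>1\<close>. This settles the tuples of channels without
  information, which the suprema in the coefficients omit.\<close>

lemma dinfo_eq_0D: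
  assumes "prior q \<pi>" "fchan q Y W" "\<And>t. 0 \<le> t \<Longrightarrow> f_KL t \<le> f t"
    and "dinfo f q \<pi> Y W = 0" "a < q" "y \<in> Y"
  shows "W a y = mix q \<pi> W y"
proof (cases "mix q \<pi> W y = 0")
  case True
  then show ?thesis using mix_zero_iff[OF assms(1,2,6)] assms(5) by simp
next
  case False
  then have m: "0 < mix q \<pi> W y" using mix_nonneg[OF assms(1,2,6)] by simp
  have "dinfo f_KL q \<pi> Y W = 0" using dinfo_mono[OF assms(1,2), of f_KL f] assms(3,4) by simp
  then have "ennreal (mix q \<pi> W y) * f_KL (W a y / mix q \<pi> W y) = 0"
  proof -
    have "ennreal (\<pi> a) * (\<Sum>y\<in>Y. ennreal (mix q \<pi> W y) * f_KL (W a y / mix q \<pi> W y)) = 0"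
      using \<open>dinfo f_KL q \<pi> Y W = 0\<close> assms(5) unfolding dinfo_def by (subst (asm) sum_eq_0_iff) auto
    then have "(\<Sum>y\<in>Y. ennreal (mix q \<pi> W y) * f_KL (W a y / mix q \<pi> W y)) = 0"
      using priorD(1)[OF assms(1,5)] by (metis ennreal_eq_0_iff mult_eq_0_iff not_le)
    then show ?thesis
      using fchanD(1)[OF assms(2)] assms(6) by (subst (asm) sum_eq_0_iff) auto
  qed
  then have "f_KL (W a y / mix q \<pi> W y) = 0" using m by simp
  then have "W a y / mix q \<pi> W y = 1"
    using m fchanD(2)[OF assms(2,5,6)] by (intro f_KL_eq_0D) auto
  then show ?thesis using m by simp
qed

lemma dinfo_const:
  assumes "prior q \<pi>" "f 1 = 0" "\<And>a b y. a < q \<Longrightarrow> b < q \<Longrightarrow> y \<in> Y \<Longrightarrow> W a y = W b y"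
  shows "dinfo f q \<pi> Y W = 0"
proof -
  have "mix q \<pi> W y = W a y" if "a < q" "y \<in> Y" for a y
  proof -
    have "mix q \<pi> W y = (\<Sum>b<q. \<pi> b * W a y)" unfolding mix_def
      using that by (intro sum.cong refl arg_cong2[where f="(*)"] assms(3)) auto
    then show ?thesis using priorD(3)[OF assms(1)] by (simp flip: sum_distrib_right)
  qed
  then have "ennreal (mix q \<pi> W y) * f (W a y / mix q \<pi> W y) = 0" if "a < q" "y \<in> Y" for a y
    using that assms(2) by (cases "W a y = 0") auto
  then have "(\<Sum>y\<in>Y. ennreal (mix q \<pi> W y) * f (W a y / mix q \<pi> W y)) = 0" if "a < q" for a
    using that by (intro sum.neutral) auto
  then show ?thesis unfolding dinfo_def by (intro sum.neutral) auto
qed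

text \<open>The normalising terms \<open>- t + 1\<close> of \<open>f_KL\<close> cancel in the sum,
  since each row and the mixture have total mass one.\<close>

lemma dinfo_KL:
  assumes "prior q \<pi>" "fchan q Y W"
  shows "dinfo f_KL q \<pi> Y W = ennreal (\<Sum>a<q. \<pi> a * (\<Sum>y\<in>Y. W a y * ln (W a y / mix q \<pi> W y)))"
    and "0 \<le> (\<Sum>a<q. \<pi> a * (\<Sum>y\<in>Y. W a y * ln (W a y / mix q \<pi> W y)))"
proof -
  let ?g = "\<lambda>t::real. t * ln t - t + 1"
  have t: "0 \<le> W a y / mix q \<pi> W y" if "a < q" "y \<in> Y" for a y
    using mix_nonneg[OF assms that(2)] fchanD(2)[OF assms(2) that] by simp
  have "mix q \<pi> W y * ?g (W a y / mix q \<pi> W y) = W a y * ln (W a y / mix q \<pi> W y) - W a y + mix q \<pi> W y"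
    if "a < q" "y \<in> Y" for a y
    using mix_zero_iff[OF assms that(2)] that by (cases "mix q \<pi> W y = 0") (auto simp: algebra_simps)
  then have "(\<Sum>a<q. \<pi> a * (\<Sum>y\<in>Y. mix q \<pi> W y * ?g (W a y / mix q \<pi> W y))) =
    (\<Sum>a<q. \<pi> a * (\<Sum>y\<in>Y. W a y * ln (W a y / mix q \<pi> W y) - W a y + mix q \<pi> W y))"
    by (intro sum.cong refl arg_cong2[where f="(*)"]) auto
  also have "\<dots> = (\<Sum>a<q. \<pi> a * (\<Sum>y\<in>Y. W a y * ln (W a y / mix q \<pi> W y)))"
    using fchanD(3)[OF assms(2)] sum_mix[OF assms] by (simp add: sum.distrib sum_subtractf)
  finally have eq: "(\<Sum>a<q. \<pi> a * (\<Sum>y\<in>Y. mix q \<pi> W y * ?g (W a y / mix q \<pi> W y))) = \<dots>" .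
  show "dinfo f_KL q \<pi> Y W = ennreal (\<Sum>a<q. \<pi> a * (\<Sum>y\<in>Y. W a y * ln (W a y / mix q \<pi> W y)))"
    "0 \<le> (\<Sum>a<q. \<pi> a * (\<Sum>y\<in>Y. W a y * ln (W a y / mix q \<pi> W y)))"
    using dinfo_real[OF assms, of f_KL ?g, unfolded eq, OF conjI[OF f_KL_def x_ln_x_ge[OF t]]] by blast+
qed

section \<open>Subadditivity of KL information\<close>

definition tensor :: "(nat \<Rightarrow> 'b \<Rightarrow> real) \<Rightarrow> (nat \<Rightarrow> 'c \<Rightarrow> real) \<Rightarrow> nat \<Rightarrow> 'b \<times> 'c \<Rightarrow> real" where
  "tensor W U a p = W a (fst p) * U a (snd p)"

lemma fchan_tensor:
  assumes "fchan q Y W" "fchan q Z U"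
  shows "fchan q (Y \<times> Z) (tensor W U)"
proof -
  have "(\<Sum>p\<in>Y \<times> Z. tensor W U a p) = 1" if "a < q" for a
    using fchanD(3)[OF assms(1) that] fchanD(3)[OF assms(2) that]
    by (simp add: tensor_def sum.cartesian_product' flip: sum_product)
  then show ?thesis using assms by (auto simp: fchan_def tensor_def)
qed

text \<open>The log-likelihood ratio of the pair is the sum of the two marginal ones plus
  \<open>ln (?m y * ?n z / ?M (y,z))\<close>. The average of this correction is minus the divergence
  of the output law from the product of its marginals, hence at most zero.\<close>

lemma dinfo_KL_tensor:
  assumes P: "prior q \<pi>" and W: "fchan q Y W" and U: "fchan q Z U"
  shows "dinfo f_KL q \<pi> (Y \<times> Z) (tensor W U) \<le> dinfo f_KL q \<pi> Y W + dinfo f_KL q \<pi> Z U"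
proof -
  note T = fchan_tensor[OF W U]
  let ?M = "mix q \<pi> (tensor W U)" and ?m = "mix q \<pi> W" and ?n = "mix q \<pi> U"
  let ?l = "\<lambda>a y. ln (W a y / ?m y)" and ?k = "\<lambda>a z. ln (U a z / ?n z)"
  have split: "tensor W U a (y,z) * ln (tensor W U a (y,z) / ?M (y,z)) =
     W a y * U a z * (?l a y + ?k a z) + tensor W U a (y,z) * ln (?m y * ?n z / ?M (y,z))"
    if "a < q" "y \<in> Y" "z \<in> Z" for a y z
  proof (cases "W a y = 0 \<or> U a z = 0")
    case False
    then have "0 < W a y" "0 < U a z" using fchanD(2)[OF W] fchanD(2)[OF U] that by force+
    moreover from this have "0 < ?m y" "0 < ?n z" "0 < ?M (y,z)"
      using mix_nonneg[OF P W that(2)] mix_nonneg[OF P U that(3)] mix_nonneg[OF P T, of "(y,z)"]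
        mix_zero_iff[OF P W that(2)] mix_zero_iff[OF P U that(3)] mix_zero_iff[OF P T, of "(y,z)"] that
      by (force simp: tensor_def)+
    ultimately show ?thesis by (simp add: tensor_def ln_div ln_mult algebra_simps)
  qed (auto simp: tensor_def)
  \<comment> \<open>Gibbs' inequality before summation; over all pairs the right side sums to
    \<open>1 * 1 - 1 = 0\<close>.\<close>
  have gibbs: "?M p * ln (?m (fst p) * ?n (snd p) / ?M p) \<le> ?m (fst p) * ?n (snd p) - ?M p" if "p \<in> Y \<times> Z" for p
  proof (cases "?M p = 0")
    case True
    then show ?thesis using mix_nonneg[OF P W] mix_nonneg[OF P U] that by auto
  next
    case False
    then have M: "0 < ?M p" using mix_nonneg[OF P T that] by simp
    obtain a where "a < q" "W a (fst p) \<noteq> 0" "U a (snd p) \<noteq> 0"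
      using False mix_zero_iff[OF P T \<open>p \<in> Y \<times> Z\<close>] by (auto simp: tensor_def)
    then have "0 < ?m (fst p)" "0 < ?n (snd p)"
      using mix_nonneg[OF P W] mix_nonneg[OF P U] mix_zero_iff[OF P W] mix_zero_iff[OF P U] that
      by (metis less_eq_real_def mem_Times_iff)+
    then have "?M p * ln (?m (fst p) * ?n (snd p) / ?M p) \<le> ?M p * (?m (fst p) * ?n (snd p) / ?M p - 1)"
      using M by (intro mult_left_mono ln_le_minus_one) auto
    then show ?thesis using M by (simp add: algebra_simps)
  qed
  have s1: "(\<Sum>p\<in>Y \<times> Z. W a (fst p) * U a (snd p) * (?l a (fst p) + ?k a (snd p))) =
     (\<Sum>y\<in>Y. W a y * ?l a y) + (\<Sum>z\<in>Z. U a z * ?k a z)" if "a < q" for a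
  proof -
    have "(\<Sum>p\<in>Y \<times> Z. W a (fst p) * U a (snd p) * (?l a (fst p) + ?k a (snd p))) =
      (\<Sum>y\<in>Y. W a y * ?l a y) * (\<Sum>z\<in>Z. U a z) + (\<Sum>y\<in>Y. W a y) * (\<Sum>z\<in>Z. U a z * ?k a z)"
      unfolding sum_product sum.cartesian_product' sum.distrib[symmetric]
      by (intro sum.cong refl) (simp add: algebra_simps)
    then show ?thesis using fchanD(3)[OF W that] fchanD(3)[OF U that] by simp
  qed
  have e1: "(\<Sum>a<q. \<pi> a * (\<Sum>p\<in>Y \<times> Z. tensor W U a p * ln (tensor W U a p / ?M p))) =
    (\<Sum>a<q. \<pi> a * (\<Sum>p\<in>Y \<times> Z. W a (fst p) * U a (snd p) * (?l a (fst p) + ?k a (snd p)))) +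
    (\<Sum>a<q. \<pi> a * (\<Sum>p\<in>Y \<times> Z. tensor W U a p * ln (?m (fst p) * ?n (snd p) / ?M p)))"
    unfolding sum.distrib[symmetric] distrib_left[symmetric]
    by (rule sum.cong[OF refl], rule arg_cong2[where f="(*)", OF refl], rule sum.cong[OF refl]) (auto simp: split)
  have e2: "(\<Sum>a<q. \<pi> a * (\<Sum>p\<in>Y \<times> Z. W a (fst p) * U a (snd p) * (?l a (fst p) + ?k a (snd p)))) =
    (\<Sum>a<q. \<pi> a * (\<Sum>y\<in>Y. W a y * ?l a y)) + (\<Sum>a<q. \<pi> a * (\<Sum>z\<in>Z. U a z * ?k a z))"
    using s1 by (simp add: distrib_left sum.distrib)
  \<comment> \<open>The logarithm does not involve the input, so averaging over \<open>a\<close>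
    turns \<open>tensor W U a\<close> into \<open>?M\<close>.\<close>
  have e3: "(\<Sum>a<q. \<pi> a * (\<Sum>p\<in>Y \<times> Z. tensor W U a p * ln (?m (fst p) * ?n (snd p) / ?M p))) =
     (\<Sum>p\<in>Y \<times> Z. ?M p * ln (?m (fst p) * ?n (snd p) / ?M p))"
    unfolding mix_def[of q \<pi> "tensor W U"] sum_distrib_right sum_distrib_left
    by (subst sum.swap) (simp add: mult.assoc)
  have "(\<Sum>p\<in>Y \<times> Z. ?M p * ln (?m (fst p) * ?n (snd p) / ?M p)) \<le> (\<Sum>p\<in>Y \<times> Z. ?m (fst p) * ?n (snd p) - ?M p)"
    using gibbs by (rule sum_mono)
  also have "\<dots> = 0"
  proof -
    have "(\<Sum>p\<in>Y \<times> Z. ?m (fst p) * ?n (snd p)) = (\<Sum>y\<in>Y. ?m y) * (\<Sum>z\<in>Z. ?n z)"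
      by (simp add: sum_product sum.cartesian_product')
    then show ?thesis
      unfolding sum_subtractf sum_mix[OF P T] sum_mix[OF P W] sum_mix[OF P U] by simp
  qed
  finally have e4: "(\<Sum>p\<in>Y \<times> Z. ?M p * ln (?m (fst p) * ?n (snd p) / ?M p)) \<le> 0" .
  have le: "(\<Sum>a<q. \<pi> a * (\<Sum>p\<in>Y \<times> Z. tensor W U a p * ln (tensor W U a p / ?M p))) \<le>
     (\<Sum>a<q. \<pi> a * (\<Sum>y\<in>Y. W a y * ?l a y)) + (\<Sum>a<q. \<pi> a * (\<Sum>z\<in>Z. U a z * ?k a z))"
    using e4 unfolding e1 e2 e3 by linarith
  show ?thesis
    unfolding dinfo_KL(1)[OF P T] dinfo_KL(1)[OF P W] dinfo_KL(1)[OF P U]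
      ennreal_plus[OF dinfo_KL(2)[OF P W] dinfo_KL(2)[OF P U], symmetric]
    using le by (rule ennreal_leI)
qed

section \<open>Subadditivity of SKL information\<close>

text \<open>\<open>f_SKL\<close> is infinite exactly at \<open>0\<close>, so finiteness means that
  all rows have the same support.\<close>

lemma dinfo_SKL_finite_iff:
  assumes P: "prior q \<pi>" and W: "fchan q Y W"
  shows "dinfo f_SKL q \<pi> Y W < \<infinity> \<longleftrightarrow> (\<forall>a<q. \<forall>y\<in>Y. 0 < mix q \<pi> W y \<longrightarrow> 0 < W a y)"
proof
  assume fin: "dinfo f_SKL q \<pi> Y W < \<infinity>"
  show "\<forall>a<q. \<forall>y\<in>Y. 0 < mix q \<pi> W y \<longrightarrow> 0 < W a y"
  proof (intro allI ballI impI)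
    fix a y assume a: "a < q" "y \<in> Y" "0 < mix q \<pi> W y"
    have "ennreal (\<pi> a) * (\<Sum>y\<in>Y. ennreal (mix q \<pi> W y) * f_SKL (W a y / mix q \<pi> W y)) < \<infinity>"
      using fin a(1) unfolding dinfo_def by (simp add: ennreal_sum_less_top)
    then have "(\<Sum>y\<in>Y. ennreal (mix q \<pi> W y) * f_SKL (W a y / mix q \<pi> W y)) < \<infinity>"
      using priorD(1)[OF P a(1)] by (auto simp: ennreal_mult_less_top)
    then have "ennreal (mix q \<pi> W y) * f_SKL (W a y / mix q \<pi> W y) < \<infinity>"
      using a(2) fchanD(1)[OF W] by (simp add: ennreal_sum_less_top)
    then have "f_SKL (W a y / mix q \<pi> W y) < \<infinity>" using a(3) by (auto simp: ennreal_mult_less_top)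
    then have "W a y \<noteq> 0" by (auto simp: f_SKL_def)
    then show "0 < W a y" using fchanD(2)[OF W a(1,2)] by simp
  qed
next
  assume *: "\<forall>a<q. \<forall>y\<in>Y. 0 < mix q \<pi> W y \<longrightarrow> 0 < W a y"
  have "f_SKL (W a y / mix q \<pi> W y) < \<infinity>" if "a < q" "y \<in> Y" "0 < mix q \<pi> W y" for a y
    using * that by (force simp: f_SKL_def)
  then have "ennreal (mix q \<pi> W y) * f_SKL (W a y / mix q \<pi> W y) < \<infinity>" if "a < q" "y \<in> Y" for a y
    using that mix_nonneg[OF P W that(2)]
    by (cases "mix q \<pi> W y = 0") (auto simp: ennreal_mult_less_top)
  then show "dinfo f_SKL q \<pi> Y W < \<infinity>"
    using fchanD(1)[OF W] unfolding dinfo_def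
    by (auto simp: ennreal_sum_less_top ennreal_mult_less_top)
qed

lemma x_minus_1_ln_nonneg: "0 < t \<Longrightarrow> (0::real) \<le> (t - 1) * ln t"
  by (cases "t \<le> 1") (auto intro: mult_nonpos_nonpos mult_nonneg_nonneg)

lemma dinfo_SKL:
  assumes P: "prior q \<pi>" and W: "fchan q Y W" and fin: "dinfo f_SKL q \<pi> Y W < \<infinity>"
  shows "dinfo f_SKL q \<pi> Y W = ennreal (\<Sum>a<q. \<pi> a * (\<Sum>y\<in>Y. (W a y - mix q \<pi> W y) * ln (W a y / mix q \<pi> W y)))"
    and "0 \<le> (\<Sum>a<q. \<pi> a * (\<Sum>y\<in>Y. (W a y - mix q \<pi> W y) * ln (W a y / mix q \<pi> W y)))"
proof -
  let ?g = "\<lambda>t::real. (t - 1) * ln t"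
  have pos: "0 < W a y" if "a < q" "y \<in> Y" "0 < mix q \<pi> W y" for a y
    using fin dinfo_SKL_finite_iff[OF P W] that by auto
  have "mix q \<pi> W y * ?g (W a y / mix q \<pi> W y) = (W a y - mix q \<pi> W y) * ln (W a y / mix q \<pi> W y)"
    if "a < q" "y \<in> Y" for a y
  proof -
    have "mix q \<pi> W y * (W a y / mix q \<pi> W y - 1) = W a y - mix q \<pi> W y"
      using mix_zero_iff[OF P W that(2)] that by (cases "mix q \<pi> W y = 0") (auto simp: algebra_simps)
    then show ?thesis by (simp only: mult.assoc[symmetric])
  qed
  then have eq: "(\<Sum>a<q. \<pi> a * (\<Sum>y\<in>Y. mix q \<pi> W y * ?g (W a y / mix q \<pi> W y))) =
    (\<Sum>a<q. \<pi> a * (\<Sum>y\<in>Y. (W a y - mix q \<pi> W y) * ln (W a y / mix q \<pi> W y)))"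
    
    by (rule_tac sum.cong[OF refl], rule_tac arg_cong2[where f="(*)", OF refl], rule_tac sum.cong[OF refl])
       (simp only: lessThan_iff)
  have "f_SKL (W a y / mix q \<pi> W y) = ennreal (?g (W a y / mix q \<pi> W y)) \<and> 0 \<le> ?g (W a y / mix q \<pi> W y)"
    if "a < q" "y \<in> Y" "0 < mix q \<pi> W y" for a y
    using pos[OF that] that(3) x_minus_1_ln_nonneg[of "W a y / mix q \<pi> W y"] by (auto simp: f_SKL_def)
  from dinfo_real[OF P W, of f_SKL ?g, OF this, unfolded eq]
  show "dinfo f_SKL q \<pi> Y W = ennreal (\<Sum>a<q. \<pi> a * (\<Sum>y\<in>Y. (W a y - mix q \<pi> W y) * ln (W a y / mix q \<pi> W y)))"
    "0 \<le> (\<Sum>a<q. \<pi> a * (\<Sum>y\<in>Y. (W a y - mix q \<pi> W y) * ln (W a y / mix q \<pi> W y)))"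
    by simp_all
qed

text \<open>If both informations are finite there is even equality. The marginal log ratios are
  summed against \<open>tensor W U a - ?M\<close>, whose marginals are \<open>W a - ?m\<close> and
  \<open>U a - ?n\<close>; the correction term does not involve the input and drops out, because
  this difference averages to zero over the prior.\<close>

lemma dinfo_SKL_tensor:
  assumes P: "prior q \<pi>" and W: "fchan q Y W" and U: "fchan q Z U"
  shows "dinfo f_SKL q \<pi> (Y \<times> Z) (tensor W U) \<le> dinfo f_SKL q \<pi> Y W + dinfo f_SKL q \<pi> Z U"
proof (cases "dinfo f_SKL q \<pi> Y W < \<infinity> \<and> dinfo f_SKL q \<pi> Z U < \<infinity>")
  case False
  then show ?thesis by (auto simp: top.not_eq_extremum[symmetric])
next
  case True
  note T = fchan_tensor[OF W U]
  let ?M = "mix q \<pi> (tensor W U)" and ?m = "mix q \<pi> W" and ?n = "mix q \<pi> U"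
  let ?l = "\<lambda>a y. ln (W a y / ?m y)" and ?k = "\<lambda>a z. ln (U a z / ?n z)"
  have pW: "0 < W a y" if "a < q" "y \<in> Y" "0 < ?m y" for a y
    using True dinfo_SKL_finite_iff[OF P W] that by auto
  have pU: "0 < U a z" if "a < q" "z \<in> Z" "0 < ?n z" for a z
    using True dinfo_SKL_finite_iff[OF P U] that by auto
  have Mpos: "0 < ?m (fst p) \<and> 0 < ?n (snd p)" if "p \<in> Y \<times> Z" "0 < ?M p" for p
  proof -
    from that have "?M p \<noteq> 0" by simp
    then obtain a where "a < q" "W a (fst p) \<noteq> 0" "U a (snd p) \<noteq> 0"
      using mix_zero_iff[OF P T \<open>p \<in> Y \<times> Z\<close>] by (auto simp: tensor_def)
    then show ?thesis
      using mix_nonneg[OF P W] mix_nonneg[OF P U] mix_zero_iff[OF P W] mix_zero_iff[OF P U] that(1)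
      by (metis less_eq_real_def mem_Times_iff)
  qed
  have fT: "dinfo f_SKL q \<pi> (Y \<times> Z) (tensor W U) < \<infinity>"
    unfolding dinfo_SKL_finite_iff[OF P T] using pW pU Mpos by (auto simp: tensor_def)
  have split: "(tensor W U a p - ?M p) * ln (tensor W U a p / ?M p) =
     (tensor W U a p - ?M p) * ?l a (fst p) + (tensor W U a p - ?M p) * ?k a (snd p) +
     (tensor W U a p - ?M p) * ln (?m (fst p) * ?n (snd p) / ?M p)"
    if "a < q" "p \<in> Y \<times> Z" for a p
  proof (cases "?M p = 0")
    case True
    then show ?thesis using mix_zero_iff[OF P T that(2)] that(1) by simp
  next
    case False
    then have M: "0 < ?M p" using mix_nonneg[OF P T that(2)] by simp
    then have "0 < ?m (fst p)" "0 < ?n (snd p)" using Mpos that by auto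
    moreover from this have "0 < W a (fst p)" "0 < U a (snd p)" using pW pU that by auto
    ultimately have "ln (tensor W U a p / ?M p) = ?l a (fst p) + ?k a (snd p) + ln (?m (fst p) * ?n (snd p) / ?M p)"
      using M by (simp add: tensor_def ln_div ln_mult)
    then show ?thesis by (simp add: algebra_simps)
  qed
  have margZ: "(\<Sum>z\<in>Z. tensor W U a (y,z) - ?M (y,z)) = W a y - ?m y" if "a < q" for a y
  proof -
    have "(\<Sum>z\<in>Z. ?M (y,z)) = (\<Sum>a<q. \<pi> a * W a y * (\<Sum>z\<in>Z. U a z))"
      unfolding mix_def tensor_def by (subst sum.swap) (simp add: sum_distrib_left mult.assoc)
    also have "\<dots> = ?m y" using fchanD(3)[OF U] by (simp add: mix_def)
    finally show ?thesis using fchanD(3)[OF U that]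
      by (simp add: sum_subtractf) (simp add: tensor_def flip: sum_distrib_left)
  qed
  have margY: "(\<Sum>y\<in>Y. tensor W U a (y,z) - ?M (y,z)) = U a z - ?n z" if "a < q" for a z
  proof -
    have "(\<Sum>y\<in>Y. ?M (y,z)) = (\<Sum>a<q. \<pi> a * U a z * (\<Sum>y\<in>Y. W a y))"
      unfolding mix_def tensor_def by (subst sum.swap) (simp add: sum_distrib_left mult_ac)
    also have "\<dots> = ?n z" using fchanD(3)[OF W] by (simp add: mix_def)
    finally show ?thesis using fchanD(3)[OF W that]
      by (simp add: sum_subtractf) (simp add: tensor_def flip: sum_distrib_right)
  qed
  have s1: "(\<Sum>p\<in>Y \<times> Z. (tensor W U a p - ?M p) * ?l a (fst p)) = (\<Sum>y\<in>Y. (W a y - ?m y) * ?l a y)"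
    if "a < q" for a
    using margZ[OF that] by (simp add: sum.cartesian_product' flip: sum_distrib_right)
  have s2: "(\<Sum>p\<in>Y \<times> Z. (tensor W U a p - ?M p) * ?k a (snd p)) = (\<Sum>z\<in>Z. (U a z - ?n z) * ?k a z)"
    if "a < q" for a
    using margY[OF that]
    by (simp add: sum.cartesian_product') (subst sum.swap, simp flip: sum_distrib_right)
  have zero: "(\<Sum>a<q. \<pi> a * (\<Sum>p\<in>Y \<times> Z. (tensor W U a p - ?M p) * ln (?m (fst p) * ?n (snd p) / ?M p))) = 0"
  proof -
    have "(\<Sum>a<q. \<pi> a * (tensor W U a p - ?M p)) = 0" for p
      using priorD(3)[OF P] 
      by (simp add: right_diff_distrib sum_subtractf flip: sum_distrib_right) (simp add: mix_def)
    then have "(\<Sum>p\<in>Y \<times> Z. (\<Sum>a<q. \<pi> a * (tensor W U a p - ?M p)) * ln (?m (fst p) * ?n (snd p) / ?M p)) = 0"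
      by simp
    then show ?thesis unfolding sum_distrib_right sum_distrib_left
      by (subst sum.swap) (simp add: mult.assoc)
  qed
  have eq: "(\<Sum>a<q. \<pi> a * (\<Sum>p\<in>Y \<times> Z. (tensor W U a p - ?M p) * ln (tensor W U a p / ?M p))) =
     (\<Sum>a<q. \<pi> a * (\<Sum>y\<in>Y. (W a y - ?m y) * ?l a y)) + (\<Sum>a<q. \<pi> a * (\<Sum>z\<in>Z. (U a z - ?n z) * ?k a z))"
    using zero by (simp add: split s1 s2 sum.distrib distrib_left)
  show ?thesis
    unfolding dinfo_SKL(1)[OF P T fT] dinfo_SKL(1)[OF P W conjunct1[OF True]] dinfo_SKL(1)[OF P U conjunct2[OF True]]
      ennreal_plus[OF dinfo_SKL(2)[OF P W conjunct1[OF True]] dinfo_SKL(2)[OF P U conjunct2[OF True]], symmetric] eq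
    by (rule order_refl)
qed

section \<open>Chi-squared information of symmetric binary channels\<close>

text \<open>Finite form of \<open>bms_inv\<close>; the converse exchange
  \<open>W 1 y = W 0 (s y)\<close> follows as \<open>s\<close> is an involution.\<close>

definition symch :: "'b set \<Rightarrow> (nat \<Rightarrow> 'b \<Rightarrow> real) \<Rightarrow> bool" where
  "symch Y W \<longleftrightarrow> (\<exists>s. \<forall>y\<in>Y. s y \<in> Y \<and> s (s y) = y \<and> W 0 y = W 1 (s y))"

text \<open>With a uniform input the two rows deviate from their midpoint by opposite amounts, so
  both inputs contribute equally. The sum is half the triangular (Vincze-Le Cam) divergence.\<close>

lemma dinfo_chi2_binary:
  assumes P: "prior 2 \<pi>" and h: "\<pi> 0 = 1/2" "\<pi> 1 = 1/2" and W: "fchan 2 Y W"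
  shows "dinfo f_chi2 2 \<pi> Y W = ennreal (\<Sum>y\<in>Y. (W 0 y - W 1 y)^2 / (2 * (W 0 y + W 1 y)))"
    and "0 \<le> (\<Sum>y\<in>Y. (W 0 y - W 1 y)^2 / (2 * (W 0 y + W 1 y)))"
proof -
  have 2: "{..<2::nat} = {0,1}" by auto
  have m: "mix 2 \<pi> W y = (W 0 y + W 1 y) / 2" for y by (simp add: mix_def 2 h[unfolded One_nat_def])
  have "((x + y) / 2) * (x / ((x + y) / 2) - 1)^2 = (x - y)^2 / (2 * (x + y))" if "0 \<le> x" "0 \<le> y" for x y :: real
  proof (cases "x + y = 0")
    case False
    then show ?thesis by (simp add: divide_simps) (simp add: power2_eq_square algebra_simps)
  qed simp
  note id = this
  have "mix 2 \<pi> W y * (W 0 y / mix 2 \<pi> W y - 1)^2 = (W 0 y - W 1 y)^2 / (2 * (W 0 y + W 1 y))"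
    "mix 2 \<pi> W y * (W 1 y / mix 2 \<pi> W y - 1)^2 = (W 0 y - W 1 y)^2 / (2 * (W 0 y + W 1 y))" if "y \<in> Y" for y
  proof -
    have nn: "0 \<le> W 0 y" "0 \<le> W 1 y" using fchanD(2)[OF W _ that] by auto
    show "mix 2 \<pi> W y * (W 0 y / mix 2 \<pi> W y - 1)^2 = (W 0 y - W 1 y)^2 / (2 * (W 0 y + W 1 y))"
      unfolding m by (rule id[OF nn])
    have "(W 1 y - W 0 y)^2 / (2 * (W 1 y + W 0 y)) = (W 0 y - W 1 y)^2 / (2 * (W 0 y + W 1 y))"
      by (simp only: add.commute power2_commute)
    then show "mix 2 \<pi> W y * (W 1 y / mix 2 \<pi> W y - 1)^2 = (W 0 y - W 1 y)^2 / (2 * (W 0 y + W 1 y))"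
      unfolding m using id[OF nn(2,1)] by (simp only: add.commute[of "W 1 y" "W 0 y"])
  qed
  then have eq: "(\<Sum>a<2. \<pi> a * (\<Sum>y\<in>Y. mix 2 \<pi> W y * (W a y / mix 2 \<pi> W y - 1)^2)) = 
    (\<Sum>y\<in>Y. (W 0 y - W 1 y)^2 / (2 * (W 0 y + W 1 y)))"
    unfolding 2 by (simp add: h[unfolded One_nat_def] mult.commute)
  show "dinfo f_chi2 2 \<pi> Y W = ennreal (\<Sum>y\<in>Y. (W 0 y - W 1 y)^2 / (2 * (W 0 y + W 1 y)))"
    "0 \<le> (\<Sum>y\<in>Y. (W 0 y - W 1 y)^2 / (2 * (W 0 y + W 1 y)))"
    using dinfo_real[OF P W, of f_chi2 "\<lambda>t. (t - 1)^2"] unfolding eq by (auto simp: f_chi2_def)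
qed

text \<open>In the variables of the proof the left side is \<open>w * v\<close> times
  \<open>2 * (t^2 + u^2 - 2 * (t*u)^2) / (1 - (t*u)^2)\<close>, the right side is
  \<open>w * v\<close> times \<open>2 * (t^2 + u^2)\<close>, and \<open>t^2 + u^2 \<le> 2\<close>
  decides. The two terms on the left have to be taken together: for \<open>t = u = 1/2\<close> the
  first alone exceeds half of the right side.\<close>

lemma chi2_symmetrized_bound:
  fixes a b c d :: real
  assumes "0 \<le> a" "0 \<le> b" "0 \<le> c" "0 \<le> d"
  shows "(a*c - b*d)^2 / (2*(a*c + b*d)) + (a*d - b*c)^2 / (2*(a*d + b*c))
    \<le> (c + d) * ((a - b)^2 / (2*(a + b))) + (a + b) * ((c - d)^2 / (2*(c + d)))"
proof (cases "a*c + b*d = 0 \<or> a*d + b*c = 0")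
  \<comment> \<open>A vanishing denominator forces two of the four numbers to vanish; quotients by
    zero are \<open>0\<close>.\<close>
  case True
  then have "(a = 0 \<and> b = 0) \<or> (c = 0 \<and> d = 0) \<or> (a = 0 \<and> d = 0) \<or> (b = 0 \<and> c = 0) \<or>
    (a = 0 \<and> c = 0) \<or> (b = 0 \<and> d = 0)"
    using assms by (auto simp: add_nonneg_eq_0_iff)
  then show ?thesis using assms
    by (elim disjE) (auto simp: power2_eq_square divide_simps split: if_splits)
next
  case False
  then have p: "0 < a*c + b*d" "0 < a*d + b*c" using assms by (auto simp: less_le add_nonneg_nonneg)
  have "0 < a + b" "0 < c + d" using assms p by (auto simp: less_le add_nonneg_eq_0_iff)
  \<comment> \<open>Mean mass and bias of each pair; multiplying two pairs gives the bias
    \<open>(t + u) / (1 + t*u)\<close>.\<close>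
  define w t v u where "w = (a + b) / 2" and "t = (a - b) / (a + b)" and "v = (c + d) / 2" and "u = (c - d) / (c + d)"
  have wv: "0 < w" "0 < v" using \<open>0 < a + b\<close> \<open>0 < c + d\<close> by (auto simp: w_def v_def)
  have eqs: "a = w * (1 + t)" "b = w * (1 - t)" "c = v * (1 + u)" "d = v * (1 - u)"
    using \<open>0 < a + b\<close> \<open>0 < c + d\<close> by (auto simp: w_def t_def v_def u_def divide_simps)
  have t1: "t^2 \<le> 1" "u^2 \<le> 1"
    using assms \<open>0 < a + b\<close> \<open>0 < c + d\<close> by (auto simp: abs_square_le_1 t_def u_def)
  have e1: "a*c + b*d = 2*(w * v)*(1 + t*u)" "a*d + b*c = 2*(w * v)*(1 - t*u)"
     "a*c - b*d = 2*(w * v)*(t + u)" "a*d - b*c = 2*(w * v)*(t - u)" "a + b = 2*w" "c + d = 2 * v" "a - b = 2*w*t" "c - d = 2 * v * u"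
    by (auto simp: eqs algebra_simps)
  have "0 < 2 * (w * v)" using wv by simp
  then have pp: "0 < 1 + t*u" "0 < 1 - t*u" using p unfolding e1 by (metis zero_less_mult_pos)+
  have "(t + u)^2 / (1 + t*u) + (t - u)^2 / (1 - t*u) = 2 * (t^2 + u^2 - 2 * (t*u)^2) / (1 - (t*u)^2)"
  proof -
    have id: "(x + 2*p) / (1 + p) + (x - 2*p) / (1 - p) = 2 * (x - 2 * p^2) / (1 - p^2)"
      if "0 < 1 + p" "0 < 1 - p" for x p :: real
    proof -
      have "1 - p^2 = (1 + p) * (1 - p)" by (simp add: power2_eq_square algebra_simps)
      then show ?thesis using that by (simp add: divide_simps) (simp add: power2_eq_square algebra_simps)
    qed
    have "(t + u)^2 = t^2 + u^2 + 2*(t*u)" "(t - u)^2 = t^2 + u^2 - 2*(t*u)"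
      by (simp_all add: power2_eq_square algebra_simps)
    then show ?thesis using id[OF pp] by simp
  qed
  also have "\<dots> \<le> 2 * (t^2 + u^2)"
  proof -
    have "0 < 1 - (t*u)^2" using mult_pos_pos[OF pp] by (simp add: power2_eq_square algebra_simps)
    moreover have "(t^2 + u^2) * (t*u)^2 \<le> 2 * (t*u)^2" using t1 by (intro mult_right_mono) auto
    ultimately show ?thesis by (simp add: divide_simps) (simp add: algebra_simps)
  qed
  finally have "(w * v) * ((t + u)^2 / (1 + t*u) + (t - u)^2 / (1 - t*u)) \<le> (w * v) * (2 * (t^2 + u^2))"
    using wv by (intro mult_left_mono) auto
  moreover have "(a*c - b*d)^2 / (2*(a*c + b*d)) = (w * v) * ((t + u)^2 / (1 + t*u))"
    "(a*d - b*c)^2 / (2*(a*d + b*c)) = (w * v) * ((t - u)^2 / (1 - t*u))"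
    "(c + d) * ((a - b)^2 / (2*(a + b))) = (w * v) * (2 * t^2)"
    "(a + b) * ((c - d)^2 / (2*(c + d))) = (w * v) * (2 * u^2)"
    unfolding e1 using wv pp by (simp_all add: power2_eq_square)
  ultimately show ?thesis by (simp add: algebra_simps)
qed

text \<open>The involution pairs the output \<open>(y, z)\<close> with \<open>(y, s z)\<close>, and
  the sum of the two terms is what \<open>chi2_symmetrized_bound\<close> controls. Symmetry is asked
  of the factor being added, so a product can be built up one symmetric factor at a time.\<close>

lemma dinfo_chi2_tensor:
  assumes P: "prior 2 \<pi>" and h: "\<pi> 0 = 1/2" "\<pi> 1 = 1/2" and W: "fchan 2 Y W" and U: "fchan 2 Z U" and S: "symch Z U"
  shows "dinfo f_chi2 2 \<pi> (Y \<times> Z) (tensor W U) \<le> dinfo f_chi2 2 \<pi> Y W + dinfo f_chi2 2 \<pi> Z U"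
proof -
  note T = fchan_tensor[OF W U]
  let ?g = "\<lambda>a b::real. (a - b)^2 / (2 * (a + b))"
  obtain s where s: "\<And>z. z \<in> Z \<Longrightarrow> s z \<in> Z \<and> s (s z) = z \<and> U 0 z = U 1 (s z)"
    using S unfolding symch_def by blast
  have s': "U 1 z = U 0 (s z)" if "z \<in> Z" for z using s[of "s z"] s[OF that] by simp
  have bij: "bij_betw s Z Z" by (rule bij_betw_byWitness[where f'=s]) (use s in auto)
  let ?L = "\<Sum>p\<in>Y \<times> Z. ?g (tensor W U 0 p) (tensor W U 1 p)"
  have L1: "?L = (\<Sum>y\<in>Y. \<Sum>z\<in>Z. ?g (W 0 y * U 0 z) (W 1 y * U 1 z))"
    by (simp add: sum.cartesian_product' tensor_def)
  also have L2: "\<dots> = (\<Sum>y\<in>Y. \<Sum>z\<in>Z. ?g (W 0 y * U 1 z) (W 1 y * U 0 z))"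
    by (rule sum.cong[OF refl], subst sum.reindex_bij_betw[OF bij, symmetric])
       (use s s' in \<open>auto intro!: sum.cong\<close>)
  finally have "2 * ?L = (\<Sum>y\<in>Y. \<Sum>z\<in>Z. ?g (W 0 y * U 0 z) (W 1 y * U 1 z) + ?g (W 0 y * U 1 z) (W 1 y * U 0 z))"
    using L1 by (simp add: sum.distrib)
  also have "\<dots> \<le> (\<Sum>y\<in>Y. \<Sum>z\<in>Z. (U 0 z + U 1 z) * ?g (W 0 y) (W 1 y) + (W 0 y + W 1 y) * ?g (U 0 z) (U 1 z))"
    using fchanD(2)[OF W] fchanD(2)[OF U] by (intro sum_mono chi2_symmetrized_bound) auto
  also have "\<dots> = (\<Sum>z\<in>Z. U 0 z + U 1 z) * (\<Sum>y\<in>Y. ?g (W 0 y) (W 1 y)) +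
      (\<Sum>y\<in>Y. W 0 y + W 1 y) * (\<Sum>z\<in>Z. ?g (U 0 z) (U 1 z))"
    unfolding sum.distrib sum_distrib_left[symmetric] sum_distrib_right[symmetric]
    by (simp add: sum_distrib_right)
  also have "\<dots> = 2 * (\<Sum>y\<in>Y. ?g (W 0 y) (W 1 y)) + 2 * (\<Sum>z\<in>Z. ?g (U 0 z) (U 1 z))"
    using fchanD(3)[OF W, of 0] fchanD(3)[OF W, of 1] fchanD(3)[OF U, of 0] fchanD(3)[OF U, of 1]
    by (simp add: sum.distrib)
  finally have "?L \<le> (\<Sum>y\<in>Y. ?g (W 0 y) (W 1 y)) + (\<Sum>z\<in>Z. ?g (U 0 z) (U 1 z))" by simp
  then show ?thesis
    unfolding dinfo_chi2_binary(1)[OF P h T] dinfo_chi2_binary(1)[OF P h W] dinfo_chi2_binary(1)[OF P h U]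
      ennreal_plus[OF dinfo_chi2_binary(2)[OF P h W] dinfo_chi2_binary(2)[OF P h U], symmetric]
    by (rule ennreal_leI)
qed

section \<open>Contraction coefficients bound finite channels\<close>

lemma prob_space_point_measure:
  assumes "finite Y" "\<And>y. y \<in> Y \<Longrightarrow> 0 \<le> w y" "(\<Sum>y\<in>Y. w y) = 1"
  shows "prob_space (point_measure Y (\<lambda>y. ennreal (w y)))"
  using assms
  by (intro prob_spaceI) (simp add: space_point_measure emeasure_point_measure_finite sum_ennreal)

text \<open>On finite spaces composition of kernels is matrix multiplication; this serves both
  \<open>mixture\<close> and \<open>compose_B\<close>.\<close>

lemma bind_point_measure:
  assumes X: "finite X" "\<And>x. x \<in> X \<Longrightarrow> 0 \<le> p x" "(\<Sum>x\<in>X. p x) = 1"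
    and Z: "finite Z" "\<And>x z. x \<in> X \<Longrightarrow> z \<in> Z \<Longrightarrow> 0 \<le> k x z" "\<And>x. x \<in> X \<Longrightarrow> (\<Sum>z\<in>Z. k x z) = 1"
    and K: "\<And>x. x \<in> X \<Longrightarrow> K x = point_measure Z (\<lambda>z. ennreal (k x z))"
  shows "bind (point_measure X (\<lambda>x. ennreal (p x))) K = point_measure Z (\<lambda>z. ennreal (\<Sum>x\<in>X. p x * k x z))"
proof -
  let ?M = "point_measure X (\<lambda>x. ennreal (p x))"
  have ne: "space ?M \<noteq> {}" using X(3) by (auto simp: space_point_measure)
  have S: "sets (bind ?M K) = Pow Z"
    using ne K by (subst sets_bind[of _ _ "count_space Z"]) (auto simp: space_point_measure sets_point_measure)
  have meas: "K \<in> measurable ?M (subprob_algebra (count_space Z))"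
    using K Z by (auto simp: space_subprob_algebra sets_point_measure intro!: prob_space_imp_subprob_space prob_space_point_measure)
  show ?thesis
  proof (rule measure_eqI)
    fix A assume "A \<in> sets (bind ?M K)"
    then have A: "A \<subseteq> Z" using S by auto
    have "emeasure (bind ?M K) A = (\<integral>\<^sup>+x. emeasure (K x) A \<partial>?M)"
      using A by (intro emeasure_bind[OF ne meas]) auto
    also have "\<dots> = (\<Sum>x\<in>X. ennreal (p x) * emeasure (K x) A)"
      using X(1) by (rule nn_integral_point_measure_finite)
    also have "\<dots> = (\<Sum>x\<in>X. ennreal (p x * (\<Sum>z\<in>A. k x z)))"
    proof (intro sum.cong refl)
      fix x assume x: "x \<in> X"
      have "emeasure (K x) A = ennreal (\<Sum>z\<in>A. k x z)"
        using K[OF x] Z A x by (simp add: emeasure_point_measure_finite subsetD sum_ennreal)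
      then show "ennreal (p x) * emeasure (K x) A = ennreal (p x * (\<Sum>z\<in>A. k x z))"
        using X(2)[OF x] Z(2)[OF x] A by (simp add: ennreal_mult sum_nonneg subsetD)
    qed
    also have "\<dots> = ennreal (\<Sum>x\<in>X. p x * (\<Sum>z\<in>A. k x z))"
      using X(2) Z(2) A by (intro sum_ennreal mult_nonneg_nonneg[OF _ sum_nonneg]) (auto simp: subsetD)
    also have "(\<Sum>x\<in>X. p x * (\<Sum>z\<in>A. k x z)) = (\<Sum>z\<in>A. \<Sum>x\<in>X. p x * k x z)"
      by (simp add: sum_distrib_left sum.swap[of _ A])
    also have "ennreal \<dots> = (\<Sum>z\<in>A. ennreal (\<Sum>x\<in>X. p x * k x z))"
      using X(2) Z(2) A by (intro sum_ennreal[symmetric] sum_nonneg mult_nonneg_nonneg) (auto simp: subsetD)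
    also have "\<dots> = emeasure (point_measure Z (\<lambda>z. ennreal (\<Sum>x\<in>X. p x * k x z))) A"
      using Z(1) A by (simp add: emeasure_point_measure_finite)
    finally show "emeasure (bind ?M K) A = \<dots>" .
  qed (simp add: S sets_point_measure)
qed

lemma PiM_point_measure:
  assumes I: "finite I" and Y: "\<And>i. i \<in> I \<Longrightarrow> finite (Y i)"
    and w: "\<And>i y. i \<in> I \<Longrightarrow> y \<in> Y i \<Longrightarrow> 0 \<le> w i y" "\<And>i. i \<in> I \<Longrightarrow> (\<Sum>y\<in>Y i. w i y) = 1"
  shows "PiM I (\<lambda>i. point_measure (Y i) (\<lambda>y. ennreal (w i y))) =
    point_measure (PiE I Y) (\<lambda>h. ennreal (\<Prod>i\<in>I. w i (h i)))"
proof -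
  \<comment> \<open>\<open>product_prob_space\<close> asks for a probability space at every index,
    so a point mass fills the positions outside \<open>I\<close>.\<close>
  define N where "N i = (if i \<in> I then point_measure (Y i) (\<lambda>y. ennreal (w i y))
     else point_measure {undefined} (\<lambda>y. ennreal 1))" for i
  have N: "prob_space (N i)" for i
    using assms prob_space_point_measure[of "{undefined}" "\<lambda>_. 1"]
    unfolding N_def by (auto intro!: prob_space_point_measure simp del: ennreal_1)
  interpret product_prob_space N
    by (intro product_prob_spaceI N)
  have eq: "PiM I (\<lambda>i. point_measure (Y i) (\<lambda>y. ennreal (w i y))) = PiM I N"
    by (rule PiM_cong) (auto simp: N_def)
  let ?Y = "\<lambda>i. if i \<in> I then Y i else {}"
  \<comment> \<open>A finite product of discrete sigma-algebras is the full power set, so it is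
    enough to compare singletons.\<close>
  have "sets (PiM I N) = sets (PiM I (\<lambda>i. count_space (?Y i)))"
    by (rule sets_PiM_cong) (auto simp: N_def sets_point_measure)
  also have "\<dots> = sets (count_space (PiE I ?Y))"
    using I Y by (subst count_space_PiM_finite) (auto intro: countable_finite)
  also have "PiE I ?Y = PiE I Y" by (rule PiE_cong) auto
  finally have S: "sets (PiM I N) = Pow (PiE I Y)" by simp
  show ?thesis unfolding eq
  proof (rule measure_eqI_finite[of _ "PiE I Y"])
    fix h assume h: "h \<in> PiE I Y"
    have "emeasure (PiM I N) {h} = emeasure (PiM I N) (PiE I (\<lambda>i. {h i}))"
      using PiE_singleton[of h I] h by (auto simp: PiE_iff)
    also have "\<dots> = (\<Prod>i\<in>I. emeasure (N i) {h i})"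
      using h by (intro emeasure_PiM[OF I]) (auto simp: N_def sets_point_measure)
    also have "\<dots> = (\<Prod>i\<in>I. ennreal (w i (h i)))"
      using h Y by (intro prod.cong refl) (auto simp: N_def emeasure_point_measure_finite2 PiE_iff)
    also have "\<dots> = ennreal (\<Prod>i\<in>I. w i (h i))"
      using h w by (intro prod_ennreal) auto
    also have "\<dots> = emeasure (point_measure (PiE I Y) (\<lambda>h. ennreal (\<Prod>i\<in>I. w i (h i)))) {h}"
      using h by (simp add: emeasure_point_measure_finite2)
    finally show "emeasure (PiM I N) {h} = \<dots>" .
  qed (auto simp: S sets_point_measure I Y finite_PiE)
qed

lemma f_info_cong:
  assumes "\<And>a. a < q \<Longrightarrow> P a = P' a" "\<And>a. a < q \<Longrightarrow> \<pi> a = \<pi>' a"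
  shows "f_info f q \<pi> P = f_info f q \<pi>' P'"
proof -
  have "point_measure {0..<q} (\<lambda>a. ennreal (\<pi> a)) = point_measure {0..<q} (\<lambda>a. ennreal (\<pi>' a))"
    unfolding point_measure_def using assms(2) by (intro density_cong) (auto simp: AE_count_space)
  then have "mixture q \<pi> P = mixture q \<pi>' P'"
    unfolding mixture_def using assms(1) by (intro bind_cong) (auto simp: space_point_measure)
  then show ?thesis unfolding f_info_def using assms by (intro sum.cong) auto
qed

text \<open>The derivative is determined only almost everywhere, that is at the points of positive
  mixture mass, and the integral sees no others.\<close>

lemma f_info_point_measure:
  assumes P: "prior q \<pi>" and W: "fchan q Y W"
  shows "f_info f q \<pi> (\<lambda>a. point_measure Y (\<lambda>y. ennreal (W a y))) = dinfo f q \<pi> Y W"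
proof -
  let ?P = "\<lambda>a. point_measure Y (\<lambda>y. ennreal (W a y))"
  let ?M = "point_measure Y (\<lambda>y. ennreal (mix q \<pi> W y))"
  have M: "mixture q \<pi> ?P = ?M"
    unfolding mixture_def mix_def lessThan_atLeast0
    by (rule bind_point_measure) (use priorD[OF P] fchanD[OF W] in \<open>auto simp: lessThan_atLeast0\<close>)
  have "prob_space ?M"
    using fchanD(1)[OF W] mix_nonneg[OF P W] sum_mix[OF P W] by (intro prob_space_point_measure) auto
  then interpret M: prob_space ?M .
  have RN: "AE y in ?M. ennreal (W a y / mix q \<pi> W y) = RN_deriv ?M (?P a) y" if a: "a < q" for a
  proof (rule M.RN_deriv_unique)
    show "(\<lambda>y. ennreal (W a y / mix q \<pi> W y)) \<in> borel_measurable ?M" by simp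
    have "ennreal (mix q \<pi> W y) * ennreal (W a y / mix q \<pi> W y) = ennreal (W a y)" if "y \<in> Y" for y
      using mix_nonneg[OF P W that] mix_zero_iff[OF P W that] a fchanD(2)[OF W a that]
      by (cases "mix q \<pi> W y = 0") (auto simp flip: ennreal_mult)
    then show "density ?M (\<lambda>y. ennreal (W a y / mix q \<pi> W y)) = ?P a"
      unfolding point_measure_def
      by (subst density_density_eq) (auto intro!: density_cong simp: AE_count_space)
  qed
  have "(\<integral>\<^sup>+ y. f (enn2real (RN_deriv ?M (?P a) y)) \<partial>?M) =
     (\<Sum>y\<in>Y. ennreal (mix q \<pi> W y) * f (W a y / mix q \<pi> W y))" if a: "a < q" for a
  proof -
    have "AE y in ?M. enn2real (RN_deriv ?M (?P a) y) = W a y / mix q \<pi> W y"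
      using RN[OF a] unfolding AE_point_measure
    proof (intro ballI impI, goal_cases)
      case (1 y)
      then have "RN_deriv ?M (?P a) y = ennreal (W a y / mix q \<pi> W y)" by auto
      then show ?case using mix_nonneg[OF P W 1(2)] fchanD(2)[OF W a 1(2)] by simp
    qed
    then have "(\<integral>\<^sup>+ y. f (enn2real (RN_deriv ?M (?P a) y)) \<partial>?M) = (\<integral>\<^sup>+ y. f (W a y / mix q \<pi> W y) \<partial>?M)"
      by (intro nn_integral_cong_AE) auto
    then show ?thesis using fchanD(1)[OF W] by (simp add: nn_integral_point_measure_finite)
  qed
  then show ?thesis unfolding f_info_def dinfo_def M by simp
qed

definition compW :: "nat \<Rightarrow> nat \<Rightarrow> (nat \<Rightarrow> (nat \<Rightarrow> nat) \<Rightarrow> real) \<Rightarrow> (nat \<Rightarrow> nat \<Rightarrow> 'b \<Rightarrow> real) \<Rightarrow> nat \<Rightarrow> (nat \<Rightarrow> 'b) \<Rightarrow> real" where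
  "compW r q B W a h = (\<Sum>x\<in>cfgs r q. B a x * (\<Prod>i<r-1. W i (x i) (h i)))"

lemma cfgs_less: "x \<in> cfgs r q \<Longrightarrow> i < r - 1 \<Longrightarrow> x i < q"
  by (auto simp: cfgs_def PiE_iff)

lemma finite_cfgs: "finite (cfgs r q)"
  by (auto simp: cfgs_def intro: finite_PiE)

lemma boht_paramsD:
  assumes "boht_params q r \<pi> B"
  shows "prior q \<pi>" "fchan q (cfgs r q) B"
  using assms by (auto simp: boht_params_def prior_def fchan_def finite_cfgs)

lemma sum_prod_channels:
  assumes "finite I" "\<And>i. i \<in> I \<Longrightarrow> finite (Y i)" "\<And>i. i \<in> I \<Longrightarrow> (\<Sum>y\<in>Y i. w i y) = (1::real)"
  shows "(\<Sum>h\<in>PiE I Y. \<Prod>i\<in>I. w i (h i)) = 1"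
  using prod_sum_PiE[of I Y w] assms by simp

lemma fchan_compW:
  assumes B: "fchan q (cfgs r q) B" and W: "\<And>i. i < r - 1 \<Longrightarrow> fchan q (Y i) (W i)"
  shows "fchan q (PiE {0..<r-1} Y) (compW r q B W)"
  unfolding fchan_def
proof (intro conjI allI impI ballI)
  show "finite (PiE {0..<r-1} Y)" using fchanD(1)[OF W] by (intro finite_PiE) auto
  fix a assume a: "a < q"
  { fix h assume h: "h \<in> PiE {0..<r-1} Y"
    show "0 \<le> compW r q B W a h"
      unfolding compW_def using fchanD(2)[OF B a] fchanD(2)[OF W cfgs_less] h
      by (intro sum_nonneg mult_nonneg_nonneg prod_nonneg) (auto simp: PiE_iff) }
  have "(\<Sum>h\<in>PiE {0..<r-1} Y. compW r q B W a h) =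
    (\<Sum>x\<in>cfgs r q. B a x * (\<Sum>h\<in>PiE {0..<r-1} Y. \<Prod>i\<in>{0..<r-1}. W i (x i) (h i)))"
    unfolding compW_def by (subst sum.swap) (simp add: sum_distrib_left lessThan_atLeast0)
  also have "\<dots> = (\<Sum>x\<in>cfgs r q. B a x)"
    using fchanD(1,3)[OF W] cfgs_less by (intro sum.cong refl) (subst sum_prod_channels, auto)
  finally show "(\<Sum>h\<in>PiE {0..<r-1} Y. compW r q B W a h) = 1" using fchanD(3)[OF B a] by simp
qed

lemma compose_B_point_measure:
  assumes B: "fchan q (cfgs r q) B" and W: "\<And>i. i < r - 1 \<Longrightarrow> fchan q (Y i) (W i)" and a: "a < q"
  shows "compose_B r q B (\<lambda>i a. point_measure (Y i) (\<lambda>y. ennreal (W i a y))) a =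
    point_measure (PiE {0..<r-1} Y) (\<lambda>h. ennreal (compW r q B W a h))"
  unfolding compose_B_def compW_def lessThan_atLeast0
proof (rule bind_point_measure)
  fix x assume x: "x \<in> cfgs r q"
  show "PiM {0..<r-1} (\<lambda>i. point_measure (Y i) (\<lambda>y. ennreal (W i (x i) y))) =
     point_measure (PiE {0..<r-1} Y) (\<lambda>h. ennreal (\<Prod>i\<in>{0..<r-1}. W i (x i) (h i)))"
    using fchanD[OF W] cfgs_less[OF x] by (intro PiM_point_measure) auto
  show "(\<Sum>h\<in>PiE {0..<r-1} Y. \<Prod>i\<in>{0..<r-1}. W i (x i) (h i)) = 1"
    using fchanD[OF W] cfgs_less[OF x] by (intro sum_prod_channels) auto
  show "0 \<le> (\<Prod>i\<in>{0..<r-1}. W i (x i) (h i))" if "h \<in> PiE {0..<r-1} Y" for h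
    using fchanD[OF W] cfgs_less[OF x] that by (intro prod_nonneg) (auto simp: PiE_iff)
qed (use fchanD[OF B] a fchanD(1)[OF W] in \<open>auto intro: finite_PiE\<close>)

section \<open>Encoding of finite outputs, and comparison with the suprema\<close>

lemma bij_betw_PiE_map:
  assumes "\<And>i. i \<in> I \<Longrightarrow> bij_betw (g i) (Y i) (Z i)"
  shows "bij_betw (\<lambda>h. \<lambda>i\<in>I. g i (h i)) (PiE I Y) (PiE I Z)"
proof (rule bij_betw_byWitness[where f'="\<lambda>h. \<lambda>i\<in>I. inv_into (Y i) (g i) (h i)"])
  show "\<forall>h\<in>PiE I Y. (\<lambda>i\<in>I. inv_into (Y i) (g i) ((\<lambda>i\<in>I. g i (h i)) i)) = h"
    using assms by (auto intro!: ext simp: PiE_iff bij_betw_def restrict_def extensional_def)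
  show "\<forall>h\<in>PiE I Z. (\<lambda>i\<in>I. g i ((\<lambda>i\<in>I. inv_into (Y i) (g i) (h i)) i)) = h"
    using assms by (auto intro!: ext simp: PiE_iff bij_betw_def restrict_def extensional_def f_inv_into_f)
  show "(\<lambda>h. \<lambda>i\<in>I. g i (h i)) ` PiE I Y \<subseteq> PiE I Z"
    using bij_betwE[OF assms] by (auto simp: PiE_iff)
  show "(\<lambda>h. \<lambda>i\<in>I. inv_into (Y i) (g i) (h i)) ` PiE I Z \<subseteq> PiE I Y"
    using assms by (auto simp: PiE_iff bij_betw_def inv_into_into)
qed

lemma real_encoding:
  assumes "finite Y"
  obtains g :: "'b \<Rightarrow> real" where "inj_on g Y"
proof -
  obtain f :: "'b \<Rightarrow> nat" where "inj_on f Y" using finite_imp_inj_to_nat_seg[OF assms] by auto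
  then have "inj_on (\<lambda>y. real (f y)) Y" by (auto simp: inj_on_def)
  then show thesis by (rule that)
qed

text \<open>The supremum defining the contraction coefficients ranges over channels with real output,
  so finite channels have to be encoded before they can be compared with it.\<close>

lemma realised_by_real_channels:
  fixes W :: "nat \<Rightarrow> nat \<Rightarrow> 'b \<Rightarrow> real"
  assumes P: "prior q \<pi>" and B: "fchan q (cfgs r q) B"
    and W: "\<And>i. i < r - 1 \<Longrightarrow> fchan q (Y i) (W i)"
  obtains Ps :: "nat \<Rightarrow> nat \<Rightarrow> real measure"
  where "\<And>i. i < r - 1 \<Longrightarrow> channel q (Ps i)"
    "\<And>f i. i < r - 1 \<Longrightarrow> f_info f q \<pi> (Ps i) = dinfo f q \<pi> (Y i) (W i)"
    "\<And>f. f_info f q \<pi> (compose_B r q B Ps) = dinfo f q \<pi> (PiE {0..<r-1} Y) (compW r q B W)"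
    "\<And>i. i < r - 1 \<Longrightarrow> q = 2 \<Longrightarrow> symch (Y i) (W i) \<Longrightarrow> bms (Ps i)"
proof -
  have "\<exists>g :: 'b \<Rightarrow> real. i < r - 1 \<longrightarrow> inj_on g (Y i)" for i
    using real_encoding[of "Y i"] fchanD(1)[OF W, of i] by metis
  then obtain g :: "nat \<Rightarrow> 'b \<Rightarrow> real" where g: "\<And>i. i < r - 1 \<Longrightarrow> inj_on (g i) (Y i)" by metis
  define Z where "Z i = g i ` Y i" for i
  define U where "U i a z = W i a (inv_into (Y i) (g i) z)" for i a z
  have bij: "bij_betw (g i) (Y i) (Z i)" if "i < r - 1" for i
    using g[OF that] by (simp add: Z_def inj_on_imp_bij_betw)
  have WU: "W i a y = U i a (g i y)" if "i < r - 1" "y \<in> Y i" for i a y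
    using g[OF that(1)] that(2) by (simp add: U_def)
  have U: "fchan q (Z i) (U i)" if i: "i < r - 1" for i
    by (rule fchan_reindex[OF bij_betw_inv_into[OF bij[OF i]] _ W[OF i]]) (simp add: U_def)
  define Ps where "Ps i a = point_measure (Z i) (\<lambda>z. ennreal (U i a z))" for i a
  show thesis
  proof (rule that[of Ps])
    fix i assume i: "i < r - 1"
    show ch: "channel q (Ps i)"
      using fchanD[OF U[OF i]] by (auto simp: channel_def Ps_def sets_point_measure intro!: prob_space_point_measure)
    show "f_info f q \<pi> (Ps i) = dinfo f q \<pi> (Y i) (W i)" for f
      unfolding Ps_def f_info_point_measure[OF P U[OF i]]
      using bij[OF i] WU[OF i] by (intro dinfo_reindex[symmetric]) auto
    assume q: "q = 2" and "symch (Y i) (W i)"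
    then obtain s where s: "\<And>y. y \<in> Y i \<Longrightarrow> s y \<in> Y i \<and> s (s y) = y \<and> W i 0 y = W i 1 (s y)"
      unfolding symch_def by blast
    \<comment> \<open>The involution of \<open>Y i\<close>, conjugated by the encoding.\<close>
    define t where "t z = g i (s (inv_into (Y i) (g i) z))" for z
    have t: "t z \<in> Z i \<and> t (t z) = z \<and> U i 0 z = U i 1 (t z)" if "z \<in> Z i" for z
    proof -
      obtain y where y: "y \<in> Y i" "z = g i y" using \<open>z \<in> Z i\<close> by (auto simp: Z_def)
      then have "t z = g i (s y)" using g[OF i] by (simp add: t_def)
      then show ?thesis using y s[OF y(1)] g[OF i] by (simp add: t_def U_def Z_def)
    qed
    have fin: "finite (Z i)" using fchanD(1)[OF U[OF i]] .
    have "bms_inv (Ps i) t" unfolding bms_inv_def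
    proof (intro conjI ballI)
      show "channel 2 (Ps i)" using ch q by simp
      show "t \<in> measurable (Ps i 0) (Ps i 0)"
        using t fin by (auto simp: Ps_def space_point_measure sets_point_measure)
      show "t (t y) = y" if "y \<in> space (Ps i 0)" for y using that t by (simp add: Ps_def space_point_measure)
      fix E assume "E \<in> sets (Ps i 0)"
      then have E: "E \<subseteq> Z i" by (simp add: Ps_def sets_point_measure)
      then have "inj_on t E" using t by (metis inj_on_def subsetD)
      then have "(\<Sum>z\<in>t ` E. ennreal (U i 1 z)) = (\<Sum>z\<in>E. ennreal (U i 0 z))"
        using t E by (auto simp: sum.reindex intro!: sum.cong)
      moreover have "t ` E \<subseteq> Z i" using t E by auto
      ultimately show "emeasure (Ps i 0) E = emeasure (Ps i 1) (t ` E)"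
        using fin E by (simp add: Ps_def emeasure_point_measure_finite)
    qed
    then show "bms (Ps i)" by (auto simp: bms_def)
  next
    fix f
    have "f_info f q \<pi> (compose_B r q B Ps) =
      f_info f q \<pi> (\<lambda>a. point_measure (PiE {0..<r-1} Z) (\<lambda>h. ennreal (compW r q B U a h)))"
      using compose_B_point_measure[OF B U] unfolding Ps_def by (intro f_info_cong) auto
    also have "\<dots> = dinfo f q \<pi> (PiE {0..<r-1} Z) (compW r q B U)"
      by (rule f_info_point_measure[OF P fchan_compW[OF B U]])
    also have "\<dots> = dinfo f q \<pi> (PiE {0..<r-1} Y) (compW r q B W)"
    proof (rule dinfo_reindex[symmetric, OF bij_betw_PiE_map[of _ g]])
      fix a h assume "h \<in> PiE {0..<r-1} Y"
      then show "compW r q B W a h = compW r q B U a (\<lambda>i\<in>{0..<r-1}. g i (h i))"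
        unfolding compW_def by (intro sum.cong arg_cong2[where f="(*)"] prod.cong refl) (auto simp: PiE_iff WU)
    qed (use bij in auto)
    finally show "f_info f q \<pi> (compose_B r q B Ps) = dinfo f q \<pi> (PiE {0..<r-1} Y) (compW r q B W)" .
  qed
qed

lemma ennreal_le_mult_of_divide_le:
  fixes x s c :: ennreal
  assumes "x / s \<le> c" "0 < s" "s < \<infinity>"
  shows "x \<le> c * s"
proof -
  have "x = x / s * s" using assms(2,3)
    by (metis ennreal_divide_times ennreal_mult_divide_eq ennreal_times_divide infinity_ennreal_def less_numeral_extra(3) mult.commute top.not_eq_extremum)
  also have "\<dots> \<le> c * s" using assms(1) by (rule mult_right_mono) simp
  finally show ?thesis .
qed

text \<open>Covers the quotient \<open>0 / 0\<close> that the suprema leave out: each child channel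
  ignores its input, so the composed channel cannot depend on \<open>a\<close>.\<close>

lemma dinfo_compW_eq_0:
  assumes P: "prior q \<pi>" and B: "fchan q (cfgs r q) B" and W: "\<And>i. i < r - 1 \<Longrightarrow> fchan q (Y i) (W i)"
    and f: "\<And>t. 0 \<le> t \<Longrightarrow> f_KL t \<le> f t" "f 1 = 0"
    and z: "\<And>i. i < r - 1 \<Longrightarrow> dinfo f q \<pi> (Y i) (W i) = 0"
  shows "dinfo f q \<pi> (PiE {0..<r-1} Y) (compW r q B W) = 0"
proof (rule dinfo_const[OF P, of f, OF f(2)])
  fix a b h assume ab: "a < q" "b < q" and h: "h \<in> PiE {0..<r-1} Y"
  have eq: "compW r q B W a h = (\<Prod>i<r-1. mix q \<pi> (W i) (h i))" if "a < q" for a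
  proof -
    have "compW r q B W a h = (\<Sum>x\<in>cfgs r q. B a x * (\<Prod>i<r-1. mix q \<pi> (W i) (h i)))"
      unfolding compW_def
    proof (intro sum.cong arg_cong2[where f="(*)"] prod.cong refl)
      fix x i assume x: "x \<in> cfgs r q" and i: "i \<in> {..<r-1}"
      then show "W i (x i) (h i) = mix q \<pi> (W i) (h i)"
        using h by (intro dinfo_eq_0D[OF P W f(1) z]) (auto simp: cfgs_less PiE_iff)
    qed
    then show ?thesis using fchanD(3)[OF B that] by (simp flip: sum_distrib_right)
  qed
  show "compW r q B W a h = compW r q B W b h" using eq ab by simp
qed

text \<open>Once encoded, the channels are admissible in the supremum unless all their informations
  vanish; \<open>fin\<close> rules out the other excluded denominator.\<close>

lemma dinfo_compW_le_eta_ht: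
  assumes P: "prior q \<pi>" and B: "fchan q (cfgs r q) B" and W: "\<And>i. i < r - 1 \<Longrightarrow> fchan q (Y i) (W i)"
    and f: "\<And>t. 0 \<le> t \<Longrightarrow> f_KL t \<le> f t" "f 1 = 0"
    and fin: "(\<Sum>i<r-1. dinfo f q \<pi> (Y i) (W i)) < \<infinity>"
  shows "dinfo f q \<pi> (PiE {0..<r-1} Y) (compW r q B W) \<le> eta_ht f q r \<pi> B * (\<Sum>i<r-1. dinfo f q \<pi> (Y i) (W i))"
proof (cases "(\<Sum>i<r-1. dinfo f q \<pi> (Y i) (W i)) = 0")
  case True
  then show ?thesis using dinfo_compW_eq_0[OF P B W f] by simp
next
  case False
  obtain Ps :: "nat \<Rightarrow> nat \<Rightarrow> real measure" where PsC: "\<And>i. i < r - 1 \<Longrightarrow> channel q (Ps i)"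
    and Ps: "\<And>f i. i < r - 1 \<Longrightarrow> f_info f q \<pi> (Ps i) = dinfo f q \<pi> (Y i) (W i)"
    "\<And>f. f_info f q \<pi> (compose_B r q B Ps) = dinfo f q \<pi> (PiE {0..<r-1} Y) (compW r q B W)"
    and "\<And>i. i < r - 1 \<Longrightarrow> q = 2 \<Longrightarrow> symch (Y i) (W i) \<Longrightarrow> bms (Ps i)"
    by (rule realised_by_real_channels[where Y=Y and W=W, OF P B W]) (assumption, rule that, blast+)
  have S: "(\<Sum>i<r-1. f_info f q \<pi> (Ps i)) = (\<Sum>i<r-1. dinfo f q \<pi> (Y i) (W i))"
    using Ps(1) by (intro sum.cong) auto
  have "f_info f q \<pi> (compose_B r q B Ps) / (\<Sum>i<r-1. f_info f q \<pi> (Ps i)) \<le> eta_ht f q r \<pi> B"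
    unfolding eta_ht_def 
    by (rule SUP_upper, unfold mem_Collect_eq S) (use PsC fin False in \<open>auto simp: zero_less_iff_neq_zero\<close>)
  then show ?thesis unfolding S Ps(2)
    using False fin by (intro ennreal_le_mult_of_divide_le) (auto simp: zero_less_iff_neq_zero)
qed

lemma dinfo_compW_le_eta_hts:
  assumes P: "prior 2 \<pi>" and h: "\<pi> 0 = 1/2" "\<pi> 1 = 1/2"
    and B: "fchan 2 (cfgs r 2) B" and W: "\<And>i. i < r - 1 \<Longrightarrow> fchan 2 (Y i) (W i)"
    and s: "\<And>i. i < r - 1 \<Longrightarrow> symch (Y i) (W i)"
    and f: "\<And>t. 0 \<le> t \<Longrightarrow> f_KL t \<le> f t" "f 1 = 0"
    and fin: "(\<Sum>i<r-1. dinfo f 2 \<pi> (Y i) (W i)) < \<infinity>"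
  shows "dinfo f 2 \<pi> (PiE {0..<r-1} Y) (compW r 2 B W) \<le> eta_hts f r B * (\<Sum>i<r-1. dinfo f 2 \<pi> (Y i) (W i))"
proof (cases "(\<Sum>i<r-1. dinfo f 2 \<pi> (Y i) (W i)) = 0")
  case True
  then show ?thesis using dinfo_compW_eq_0[OF P B W f] by simp
next
  case False
  obtain Ps :: "nat \<Rightarrow> nat \<Rightarrow> real measure" where "\<And>i. i < r - 1 \<Longrightarrow> channel 2 (Ps i)"
    and Ps: "\<And>f i. i < r - 1 \<Longrightarrow> f_info f 2 \<pi> (Ps i) = dinfo f 2 \<pi> (Y i) (W i)"
    "\<And>f. f_info f 2 \<pi> (compose_B r 2 B Ps) = dinfo f 2 \<pi> (PiE {0..<r-1} Y) (compW r 2 B W)"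
    and bms: "\<And>i. i < r - 1 \<Longrightarrow> (2::nat) = 2 \<Longrightarrow> symch (Y i) (W i) \<Longrightarrow> bms (Ps i)"
    by (rule realised_by_real_channels[where Y=Y and W=W, OF P B W]) (assumption, rule that, blast+)
  have PsC: "bms (Ps i)" if "i < r - 1" for i using that bms s by simp
  \<comment> \<open>\<open>\<pi>\<close> and the constant prior in \<open>C_f\<close> agree on the
    labels \<open>0\<close> and \<open>1\<close>, the only ones that \<open>f_info\<close> reads
    here.\<close>
  have C: "C_f f P = f_info f 2 \<pi> P" for P :: "nat \<Rightarrow> 'c measure"
    unfolding C_f_def using h by (intro f_info_cong) (auto simp: less_2_cases_iff)
  have S: "(\<Sum>i<r-1. f_info f 2 \<pi> (Ps i)) = (\<Sum>i<r-1. dinfo f 2 \<pi> (Y i) (W i))"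
    using Ps(1) by (intro sum.cong) auto
  have "f_info f 2 \<pi> (compose_B r 2 B Ps) / (\<Sum>i<r-1. f_info f 2 \<pi> (Ps i)) \<le> eta_hts f r B"
    unfolding eta_hts_def C 
    by (rule SUP_upper, unfold mem_Collect_eq S) (use PsC fin False in \<open>auto simp: zero_less_iff_neq_zero\<close>)
  then show ?thesis unfolding S Ps(2)
    using False fin by (intro ennreal_le_mult_of_divide_le) (auto simp: zero_less_iff_neq_zero)
qed

section \<open>Truncated flows and the branching number\<close>

lemma hypertreeD:
  assumes "hypertree r V"
  shows "[] \<in> V" "\<And>u c. u @ [c] \<in> V \<Longrightarrow> u \<in> V" "\<And>u e i. u @ [(e, i)] \<in> V \<Longrightarrow> i < r - 1"
    "\<And>u e i j. u @ [(e, i)] \<in> V \<Longrightarrow> j < r - 1 \<Longrightarrow> u @ [(e, j)] \<in> V"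
    "\<And>u. u \<in> V \<Longrightarrow> finite (down_edges V u)"
  using assms unfolding hypertree_def by blast+

lemma hypertree_prefix:
  assumes "hypertree r V" "u @ w \<in> V"
  shows "u \<in> V"
  using assms(2)
proof (induction w rule: rev_induct)
  case (snoc c w)
  then show ?case using hypertreeD(2)[OF assms(1), of "u @ w" c] by simp
qed simp

text \<open>\<open>down_edges\<close> looks at position \<open>0\<close> only. A hyperedge has all
  its positions in the tree or none, so it still finds the hyperedge of every child.\<close>

lemma children_eq_image:
  assumes "hypertree r V" "2 \<le> r"
  shows "children V u = (\<lambda>p. u @ [p]) ` (down_edges V u \<times> {..<r-1})"
proof -
  have "(e, i) \<in> down_edges V u \<times> {..<r-1} \<longleftrightarrow> u @ [(e, i)] \<in> V" for e i
    using hypertreeD(3,4)[OF assms(1)] assms(2) unfolding down_edges_def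
    by (metis (no_types, lifting) SigmaD1 SigmaD2 SigmaI lessThan_iff less_diff_conv mem_Collect_eq
        nat_1_add_1 not_less_eq_eq not_le plus_1_eq_Suc add_0 le_less_trans less_le_trans zero_le)
  then show ?thesis unfolding children_def by auto
qed

lemma finite_children:
  assumes "hypertree r V" "2 \<le> r" "u \<in> V"
  shows "finite (children V u)"
  using children_eq_image[OF assms(1,2)] hypertreeD(5)[OF assms(1,3)] by simp

lemma sum_children:
  assumes "hypertree r V" "2 \<le> r"
  shows "(\<Sum>v\<in>children V u. F v) = (\<Sum>e\<in>down_edges V u. \<Sum>i<r-1. F (u @ [(e, i)]))"
  unfolding children_eq_image[OF assms]
  by (subst sum.reindex) (auto simp: inj_on_def sum.cartesian_product')

text \<open>The maximal flow through \<open>u\<close> towards the vertices \<open>n\<close> levels below it when \<open>v\<close> has capacity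
  \<open>t ^ length v\<close>.\<close>

primrec trunc_flow :: "vtx set \<Rightarrow> real \<Rightarrow> nat \<Rightarrow> vtx \<Rightarrow> real" where
  "trunc_flow V t 0 u = t ^ length u"
| "trunc_flow V t (Suc n) u = min (t ^ length u) (\<Sum>v\<in>children V u. trunc_flow V t n v)"

lemma trunc_flow_nonneg: "0 \<le> t \<Longrightarrow> 0 \<le> trunc_flow V t n u"
  by (induction n arbitrary: u) (auto intro: sum_nonneg)

text \<open>Looking one level further only adds constraints; the induction starts from the capacity
  of the vertex itself.\<close>

lemma trunc_flow_decseq: "decseq (\<lambda>n. trunc_flow V t n u)"
proof (rule decseq_SucI)
  show "trunc_flow V t (Suc n) u \<le> trunc_flow V t n u" for n
  proof (induction n arbitrary: u)
    case (Suc n)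
    have "(\<Sum>v\<in>children V u. trunc_flow V t (Suc n) v) \<le> (\<Sum>v\<in>children V u. trunc_flow V t n v)"
      by (intro sum_mono Suc)
    then show ?case unfolding trunc_flow.simps(2)[of V t _ u] by (rule min.mono[OF order_refl])
  qed simp
qed

definition lim_flow :: "vtx set \<Rightarrow> real \<Rightarrow> vtx \<Rightarrow> real" where
  "lim_flow V t u = lim (\<lambda>n. trunc_flow V t n u)"

lemma trunc_flow_tendsto:
  assumes "0 \<le> t"
  shows "(\<lambda>n. trunc_flow V t n u) \<longlonglongrightarrow> lim_flow V t u"
proof -
  have "convergent (\<lambda>n. trunc_flow V t n u)"
    using decseq_convergent[OF trunc_flow_decseq[of V t u], of 0] trunc_flow_nonneg[OF assms]
    by (metis convergentI)
  then show ?thesis unfolding lim_flow_def by (simp add: convergent_LIMSEQ_iff)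
qed

lemma lim_flow_nonneg: "0 \<le> t \<Longrightarrow> 0 \<le> lim_flow V t u"
  by (rule LIMSEQ_le_const[OF trunc_flow_tendsto]) (auto intro: trunc_flow_nonneg)

text \<open>The recursion of \<open>trunc_flow\<close> passes to the limit. The children may carry
  more than their parent, so \<open>lim_flow\<close> itself need not be a flow.\<close>

lemma lim_flow_eq:
  assumes "0 \<le> t"
  shows "lim_flow V t u = min (t ^ length u) (\<Sum>v\<in>children V u. lim_flow V t v)"
proof -
  have "(\<lambda>n. trunc_flow V t (Suc n) u) \<longlonglongrightarrow> min (t ^ length u) (\<Sum>v\<in>children V u. lim_flow V t v)"
    unfolding trunc_flow.simps by (intro tendsto_min tendsto_const tendsto_sum trunc_flow_tendsto assms)
  then show ?thesis
    using LIMSEQ_unique LIMSEQ_Suc[OF trunc_flow_tendsto[OF assms, of V u]] by blast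
qed

text \<open>The flow starts as \<open>lim_flow\<close> at the root and is divided among the children
  in proportion to \<open>lim_flow\<close>. By induction it stays below \<open>lim_flow\<close>,
  hence below the capacities.\<close>

lemma flow_of_lim_flow:
  assumes T: "hypertree r V" "2 \<le> r" and t: "0 \<le> t" and pos: "0 < lim_flow V t []"
  shows "\<exists>f. is_flow V f \<and> 0 < f [] \<and> (\<forall>u\<in>V. f u \<le> t ^ length u)"
proof -
  define S where "S u = (\<Sum>v\<in>children V u. lim_flow V t v)" for u
  \<comment> \<open>The product of the splitting proportions along the path from the root to
    \<open>u\<close>.\<close>
  define f where "f u = lim_flow V t [] *
    (\<Prod>i<length u. lim_flow V t (take (Suc i) u) / S (take i u))" for u
  note L0 = lim_flow_nonneg[OF t, of V]
  have S0: "0 \<le> S u" for u unfolding S_def by (intro sum_nonneg L0)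
  have LS: "lim_flow V t u \<le> S u" "lim_flow V t u \<le> t ^ length u" for u
    using lim_flow_eq[OF t, of V u] by (auto simp: S_def)
  have f0: "0 \<le> f u" for u
    unfolding f_def by (intro mult_nonneg_nonneg prod_nonneg divide_nonneg_nonneg L0 S0 ballI)
  have step: "f (u @ [c]) = f u * (lim_flow V t (u @ [c]) / S u)" for u c
    unfolding f_def by simp
  have le: "f u \<le> lim_flow V t u" if "u \<in> V" for u
    using that
  proof (induction u rule: rev_induct)
    case (snoc c u)
    have "u \<in> V" using hypertreeD(2)[OF T(1) snoc.prems] .
    then have "f u \<le> S u" using snoc.IH LS(1)[of u] by simp
    then have "f u / S u \<le> 1" using S0[of u] by (cases "S u = 0") (auto simp: divide_le_eq_1)
    then have "f u / S u * lim_flow V t (u @ [c]) \<le> 1 * lim_flow V t (u @ [c])"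
      by (intro mult_right_mono L0)
    then show ?case by (simp add: step)
  qed (simp add: f_def)
  have "f u = (\<Sum>v\<in>children V u. f v)" if u: "u \<in> V" for u
  proof -
    have "(\<Sum>v\<in>children V u. f v) = (\<Sum>v\<in>children V u. f u / S u * lim_flow V t v)"
      by (intro sum.cong refl) (auto simp: children_def step)
    also have "\<dots> = f u / S u * S u" by (simp only: S_def sum_distrib_left)
    also have "\<dots> = f u"
    proof (cases "S u = 0")
      \<comment> \<open>The proportions are \<open>0\<close> here by the convention for division;
        conservation survives because \<open>f u \<le> lim_flow V t u \<le> S u\<close> shows that
        nothing arrives.\<close>
      case True
      then have "f u = 0" using le[OF u] LS(1)[of u] f0[of u] by simp
      then show ?thesis by simp
    qed simp
    finally show ?thesis by simp
  qed
  then have "is_flow V f" using f0 unfolding is_flow_def by blast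
  moreover have "0 < f []" using pos by (simp add: f_def)
  moreover have "f u \<le> t ^ length u" if "u \<in> V" for u using le[OF that] LS(2)[of u] by simp
  ultimately show ?thesis by blast
qed

lemma le_br_of_lim_flow:
  assumes "hypertree r V" "2 \<le> r" "0 < t" "0 < lim_flow V t []"
  shows "ennreal (1 / t) \<le> br V"
  unfolding br_def
proof (rule SUP_upper)
  obtain f where "is_flow V f" "0 < f []" "\<forall>u\<in>V. f u \<le> t ^ length u"
    using flow_of_lim_flow[OF assms(1,2) _ assms(4)] assms(3) by auto
  then show "1 / t \<in> {l. 0 < l \<and> (\<exists>f. is_flow V f \<and> 0 < f [] \<and> (\<forall>u\<in>V. f u \<le> (1 / l) ^ length u))}"
    using assms(3) by auto
qed

text \<open>With unit capacities the path \<open>w\<close> alone carries a unit of flow.\<close>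

lemma trunc_flow_ge_1:
  assumes "hypertree r V" "2 \<le> r" "u @ w \<in> V"
  shows "1 \<le> trunc_flow V 1 (length w) u"
  using assms(3)
proof (induction w arbitrary: u)
  case (Cons c w)
  have u: "u \<in> V" "u @ [c] \<in> V"
    using hypertree_prefix[OF assms(1)] Cons.prems by (metis append_Cons append_Nil append_assoc)+
  have "1 \<le> trunc_flow V 1 (length w) (u @ [c])" using Cons.IH[of "u @ [c]"] Cons.prems by simp
  also have "\<dots> \<le> (\<Sum>v\<in>children V u. trunc_flow V 1 (length w) v)"
    using u by (intro member_le_sum finite_children[OF assms(1,2)] trunc_flow_nonneg) (auto simp: children_def)
  finally show ?case by simp
qed simp

text \<open>Prepares the case \<eta> infinite. The limit of the truncated flows replaces a
  compactness argument producing an infinite path.\<close>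

lemma br_ge_1_of_levels:
  assumes "hypertree r V" "2 \<le> r" "\<And>n. level V n \<noteq> {}"
  shows "1 \<le> br V"
proof -
  have "1 \<le> trunc_flow V 1 n []" for n
    using trunc_flow_ge_1[OF assms(1,2), of "[]"] assms(3)[of n] by (auto simp: level_def)
  then have "1 \<le> lim_flow V 1 []"
    by (intro LIMSEQ_le_const[OF trunc_flow_tendsto]) auto
  then show ?thesis using le_br_of_lim_flow[OF assms(1,2), of 1] by simp
qed

text \<open>The hypotheses mirror \<open>trunc_flow\<close>: after weighting by powers of \<eta>,
  \<open>bound\<close> supplies the capacity and \<open>rec\<close> the sum over the
  children.\<close>

lemma subharmonic_tendsto_0:
  fixes J :: "nat \<Rightarrow> vtx \<Rightarrow> ennreal" and \<eta> :: ennreal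
  assumes T: "hypertree r V" "2 \<le> r"
    and bound: "\<And>n u. u \<in> V \<Longrightarrow> J n u \<le> ennreal C" and "0 \<le> C"
    and rec: "\<And>n u. u \<in> V \<Longrightarrow> J (Suc n) u \<le> \<eta> * (\<Sum>v\<in>children V u. J n v)"
    and br: "br V * \<eta> < 1"
  shows "(\<lambda>n. J n []) \<longlonglongrightarrow> 0"
proof -
  consider "\<eta> = \<infinity>" | "\<eta> = 0" | e where "0 < e" "\<eta> = ennreal e"
    by (cases \<eta>) (auto simp: less_le)
  then show ?thesis
  proof cases
    \<comment> \<open>An infinite coefficient forces \<open>br V = 0\<close>, so some level
      \<open>m\<close> is empty, and \<open>J n u\<close> vanishes as soon as
      \<open>length u + n\<close> reaches \<open>m\<close>.\<close>
    case 1
    with br have "br V = 0" by (auto simp: ennreal_mult_top split: if_splits)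
    then obtain m where m: "level V m = {}" using br_ge_1_of_levels[OF T] by fastforce
    have "J n u = 0" if "u \<in> V" "m \<le> length u + n" for n u
      using that
    proof (induction n arbitrary: u)
      case 0
      then have "take m u \<in> level V m"
        using hypertree_prefix[OF T(1), of "take m u" "drop m u"] by (simp add: level_def)
      then show ?case using m by simp
    next
      case (Suc n)
      have "(\<Sum>v\<in>children V u. J n v) = 0"
        using Suc by (intro sum.neutral) (auto simp: children_def)
      then show ?case using rec[OF Suc.prems(1), of n] by simp
    qed
    then have "\<forall>n\<ge>m. J n [] = 0" using hypertreeD(1)[OF T(1)] by simp
    then show ?thesis by (intro tendsto_eventually) (auto simp: eventually_sequentially)
  next
    \<comment> \<open>Kept apart since the main case divides by the coefficient; \<open>br V\<close>
      may be infinite here.\<close>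
    case 2
    then have "J (Suc n) [] = 0" for n using rec[OF hypertreeD(1)[OF T(1)], of n] by simp
    then show ?thesis by (subst filterlim_sequentially_Suc[symmetric]) simp
  next
    case (3 e)
    have le: "J n u * ennreal (e ^ length u) \<le> ennreal (C * trunc_flow V e n u)" if "u \<in> V" for n u
      using that
    proof (induction n arbitrary: u)
      case 0
      then show ?case using bound[OF 0, of 0] 3(1) \<open>0 \<le> C\<close>
        by (simp add: ennreal_mult mult_right_mono)
    next
      case (Suc n)
      have "J (Suc n) u * ennreal (e ^ length u) \<le> ennreal C * ennreal (e ^ length u)"
        by (intro mult_right_mono bound Suc.prems) simp
      then have A: "J (Suc n) u * ennreal (e ^ length u) \<le> ennreal (C * e ^ length u)"
        using 3(1) \<open>0 \<le> C\<close> by (simp add: ennreal_mult)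
      have "J (Suc n) u * ennreal (e ^ length u) \<le> ennreal e * (\<Sum>v\<in>children V u. J n v) * ennreal (e ^ length u)"
        using rec[OF Suc.prems, of n] 3(2) by (intro mult_right_mono) auto
      also have "\<dots> = (\<Sum>v\<in>children V u. J n v * ennreal (e ^ length v))"
        using 3(1) unfolding sum_distrib_left sum_distrib_right
        by (intro sum.cong refl) (auto simp: children_def ennreal_mult mult_ac)
      also have "\<dots> \<le> (\<Sum>v\<in>children V u. ennreal (C * trunc_flow V e n v))"
        by (intro sum_mono Suc.IH) (auto simp: children_def)
      also have "\<dots> = ennreal (C * (\<Sum>v\<in>children V u. trunc_flow V e n v))"
        using 3(1) \<open>0 \<le> C\<close> by (subst sum_ennreal) (auto simp: trunc_flow_nonneg sum_distrib_left)
      finally have "J (Suc n) u * ennreal (e ^ length u) \<le> \<dots>" .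
      then show ?case using A by (cases "e ^ length u \<le> (\<Sum>v\<in>children V u. trunc_flow V e n v)") (simp_all add: min_def)
    qed
    have "lim_flow V e [] = 0"
    proof (rule ccontr)
      assume "lim_flow V e [] \<noteq> 0"
      then have "0 < lim_flow V e []" using lim_flow_nonneg[of e V "[]"] 3(1) by simp
      then have "ennreal (1 / e) * ennreal e \<le> br V * \<eta>"
        unfolding 3(2) by (intro mult_right_mono le_br_of_lim_flow[OF T 3(1)]) auto
      then show False using br 3(1) by (simp flip: ennreal_mult)
    qed
    then have "(\<lambda>n. ennreal (C * trunc_flow V e n [])) \<longlonglongrightarrow> ennreal (C * 0)"
      using trunc_flow_tendsto[of e V "[]"] 3(1) by (intro tendsto_ennrealI tendsto_mult tendsto_const) auto
    then have lim: "(\<lambda>n. ennreal (C * trunc_flow V e n [])) \<longlonglongrightarrow> 0" by simp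
    have "J n [] \<le> ennreal (C * trunc_flow V e n [])" for n
      using le[OF hypertreeD(1)[OF T(1)], of n] by simp
    then show ?thesis
      by (intro tendsto_sandwich[OF _ _ tendsto_const lim] always_eventually) auto
  qed
qed

section \<open>The broadcast channel below a vertex\<close>

definition prodW :: "'i set \<Rightarrow> ('i \<Rightarrow> nat \<Rightarrow> 'b \<Rightarrow> real) \<Rightarrow> nat \<Rightarrow> ('i \<Rightarrow> 'b) \<Rightarrow> real" where
  "prodW J W a h = (\<Prod>j\<in>J. W j a (h j))"

lemma fchan_prodW:
  assumes "finite J" "\<And>j. j \<in> J \<Longrightarrow> fchan q (Y j) (W j)"
  shows "fchan q (PiE J Y) (prodW J W)"
  unfolding fchan_def prodW_def
proof (intro conjI allI impI ballI)
  show "finite (PiE J Y)" using fchanD(1)[OF assms(2)] assms(1) by (intro finite_PiE) auto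
  show "0 \<le> (\<Prod>j\<in>J. W j a (h j))" if "a < q" "h \<in> PiE J Y" for a h
    using fchanD(2)[OF assms(2)] that by (intro prod_nonneg) (auto simp: PiE_iff)
  show "(\<Sum>h\<in>PiE J Y. \<Prod>j\<in>J. W j a (h j)) = 1" if "a < q" for a
    using fchanD(1)[OF assms(2)] fchanD(3)[OF assms(2) that] assms(1) by (intro sum_prod_channels) auto
qed

lemma bij_betw_PiE_insert:
  assumes "j \<notin> J"
  shows "bij_betw (\<lambda>h. (restrict h J, h j)) (PiE (insert j J) Y) (PiE J Y \<times> Y j)"
proof (rule bij_betw_byWitness[where f'="\<lambda>p. (fst p)(j := snd p)"])
  show "\<forall>h\<in>PiE (insert j J) Y. (fst (restrict h J, h j))(j := snd (restrict h J, h j)) = h"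
  proof (intro ballI ext)
    fix h i assume "h \<in> PiE (insert j J) Y"
    then show "((fst (restrict h J, h j))(j := snd (restrict h J, h j))) i = h i"
      by (cases "i = j"; cases "i \<in> J") (auto simp: PiE_iff extensional_def)
  qed
  show "\<forall>p\<in>PiE J Y \<times> Y j. (restrict ((fst p)(j := snd p)) J, ((fst p)(j := snd p)) j) = p"
  proof
    fix p assume p: "p \<in> PiE J Y \<times> Y j"
    have "restrict ((fst p)(j := snd p)) J = restrict (fst p) J"
      using assms by (auto simp: restrict_def)
    also have "\<dots> = fst p" using p by (auto simp: PiE_iff extensional_restrict)
    finally show "(restrict ((fst p)(j := snd p)) J, ((fst p)(j := snd p)) j) = p" by simp
  qed
  show "(\<lambda>h. (restrict h J, h j)) ` PiE (insert j J) Y \<subseteq> PiE J Y \<times> Y j"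
    by (auto simp: PiE_iff)
  show "(\<lambda>p. (fst p)(j := snd p)) ` (PiE J Y \<times> Y j) \<subseteq> PiE (insert j J) Y"
    using assms by (auto simp: PiE_iff extensional_def split: if_splits)
qed

text \<open>\<open>Q\<close> is the side condition under which a factor may be added: trivial for KL
  and SKL, symmetry for chi-squared. The types in \<open>two\<close> are those of an accumulated
  product and of one factor, as a hypothesis cannot be polymorphic.\<close>

lemma dinfo_prodW_le:
  fixes Y :: "'i \<Rightarrow> 'b set"
  assumes P: "prior q \<pi>" and f1: "f 1 = 0" and J: "finite J"
    and W: "\<And>j. j \<in> J \<Longrightarrow> fchan q (Y j) (W j)" and Q: "\<And>j. j \<in> J \<Longrightarrow> Q (Y j) (W j)"
    and two: "\<And>(Z :: ('i \<Rightarrow> 'b) set) U (Z' :: 'b set) U'. fchan q Z U \<Longrightarrow> fchan q Z' U' \<Longrightarrow> Q Z' U' \<Longrightarrow>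
      dinfo f q \<pi> (Z \<times> Z') (tensor U U') \<le> dinfo f q \<pi> Z U + dinfo f q \<pi> Z' U'"
  shows "dinfo f q \<pi> (PiE J Y) (prodW J W) \<le> (\<Sum>j\<in>J. dinfo f q \<pi> (Y j) (W j))"
  using J W Q
proof (induction J rule: finite_induct)
  case empty
  have "dinfo f q \<pi> (PiE {} Y) (prodW {} W) = 0"
    by (rule dinfo_const[OF P, of f, OF f1]) (simp add: prodW_def)
  then show ?case by simp
next
  case (insert j J)
  have "dinfo f q \<pi> (PiE (insert j J) Y) (prodW (insert j J) W) =
      dinfo f q \<pi> (PiE J Y \<times> Y j) (tensor (prodW J W) (W j))"
  proof (rule dinfo_reindex[OF bij_betw_PiE_insert[OF insert.hyps(2)]])
    fix a h
    show "prodW (insert j J) W a h = tensor (prodW J W) (W j) a (restrict h J, h j)"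
      using insert.hyps by (simp add: prodW_def tensor_def)
  qed
  also have "\<dots> \<le> dinfo f q \<pi> (PiE J Y) (prodW J W) + dinfo f q \<pi> (Y j) (W j)"
    using insert by (intro two fchan_prodW) auto
  also have "\<dots> \<le> (\<Sum>j\<in>J. dinfo f q \<pi> (Y j) (W j)) + dinfo f q \<pi> (Y j) (W j)"
    using insert by (intro add_right_mono) auto
  finally show ?case using insert.hyps by (simp add: add.commute)
qed

section \<open>Labelings of a level and their splitting along hyperedges\<close>

definition rel_level :: "vtx set \<Rightarrow> nat \<Rightarrow> vtx \<Rightarrow> vtx set" where
  "rel_level V k u = {v\<in>V. \<exists>w. v = u @ w \<and> length w = k}"

abbreviation labelings :: "vtx set \<Rightarrow> nat \<Rightarrow> nat \<Rightarrow> vtx \<Rightarrow> (vtx \<Rightarrow> nat) set" where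
  "labelings V q k u \<equiv> PiE (rel_level V k u) (\<lambda>_. {0..<q})"

lemma rel_level_0: "u \<in> V \<Longrightarrow> rel_level V 0 u = {u}"
  by (auto simp: rel_level_def)

lemma rel_level_Nil: "rel_level V k [] = level V k"
  by (auto simp: rel_level_def level_def)

text \<open>The entry of \<open>v\<close> at index \<open>length u\<close> tells below which child
  of \<open>u\<close> it lies; this is how a split labeling is glued together again.\<close>

lemma in_child_level:
  assumes "v \<in> rel_level V k (u @ [(e, i)])"
  shows "v \<in> rel_level V (Suc k) u" "v ! length u = (e, i)"
  using assms by (auto simp: rel_level_def nth_append)

lemma child_level_cases:
  assumes T: "hypertree r V" "2 \<le> r" and v: "v \<in> rel_level V (Suc k) u"
  obtains e i where "e \<in> down_edges V u" "i < r - 1" "v \<in> rel_level V k (u @ [(e, i)])"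
proof -
  obtain c w where w: "v \<in> V" "v = u @ c # w" "length w = k"
    using v by (auto simp: rel_level_def length_Suc_conv)
  then have "u @ [c] \<in> V" using hypertree_prefix[OF T(1), of "u @ [c]" w] by simp
  then have "u @ [c] \<in> children V u" by (auto simp: children_def)
  then obtain e i where "c = (e, i)" "e \<in> down_edges V u" "i < r - 1"
    unfolding children_eq_image[OF T] by auto
  then show thesis using that[of e i] w by (auto simp: rel_level_def)
qed

lemma child_in:
  assumes "hypertree r V" "e \<in> down_edges V u" "i < r - 1"
  shows "u @ [(e, i)] \<in> V"
  using hypertreeD(4)[OF assms(1)] assms(2,3) by (auto simp: down_edges_def)

text \<open>\<open>lawbelow\<close> is given labels for all vertices but reads one level only. This
  allows restricting labelings, as the extensional function spaces require.\<close>

lemma lawbelow_cong: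
  assumes T: "hypertree r V" and "u \<in> V" "\<And>v. v \<in> rel_level V k u \<Longrightarrow> x v = y v"
  shows "lawbelow V r q B k u a x = lawbelow V r q B k u a y"
  using assms(2,3)
proof (induction k arbitrary: u a)
  case 0
  then show ?case by (simp add: rel_level_0)
next
  case (Suc k)
  have "lawbelow V r q B k (u @ [(e, i)]) b x = lawbelow V r q B k (u @ [(e, i)]) b y"
    if "e \<in> down_edges V u" "i < r - 1" for e i b
    using that by (intro Suc.IH child_in[OF T] Suc.prems(2) in_child_level(1)) auto
  then show ?case by simp
qed

abbreviation edge_labelings :: "vtx set \<Rightarrow> nat \<Rightarrow> nat \<Rightarrow> nat \<Rightarrow> vtx \<Rightarrow> nat \<Rightarrow> (nat \<Rightarrow> vtx \<Rightarrow> nat) set" where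
  "edge_labelings V r q k u e \<equiv> PiE {0..<r-1} (\<lambda>i. labelings V q k (u @ [(e, i)]))"

abbreviation edge_law :: "vtx set \<Rightarrow> nat \<Rightarrow> nat \<Rightarrow> (nat \<Rightarrow> (nat \<Rightarrow> nat) \<Rightarrow> real) \<Rightarrow> nat \<Rightarrow> vtx \<Rightarrow> nat
    \<Rightarrow> nat \<Rightarrow> (nat \<Rightarrow> vtx \<Rightarrow> nat) \<Rightarrow> real" where
  "edge_law V r q B k u e \<equiv> compW r q B (\<lambda>i. lawbelow V r q B k (u @ [(e, i)]))"

text \<open>Restricted at every stage so that its values lie in the nested \<open>PiE\<close> sets
  on which the product channels live.\<close>

definition split_labeling :: "vtx set \<Rightarrow> nat \<Rightarrow> nat \<Rightarrow> vtx \<Rightarrow> (vtx \<Rightarrow> nat) \<Rightarrow> nat \<Rightarrow> nat \<Rightarrow> vtx \<Rightarrow> nat" where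
  "split_labeling V r k u x = (\<lambda>e\<in>down_edges V u. \<lambda>i\<in>{0..<r-1}. restrict x (rel_level V k (u @ [(e, i)])))"

lemma bij_betw_split_labeling:
  assumes T: "hypertree r V" "2 \<le> r"
  shows "bij_betw (split_labeling V r k u) (labelings V q (Suc k) u)
    (PiE (down_edges V u) (edge_labelings V r q k u))"
proof (rule bij_betw_byWitness[where
      f'="\<lambda>h. \<lambda>v\<in>rel_level V (Suc k) u. h (fst (v ! length u)) (snd (v ! length u)) v"])
  show "\<forall>x\<in>labelings V q (Suc k) u. (\<lambda>v\<in>rel_level V (Suc k) u.
      split_labeling V r k u x (fst (v ! length u)) (snd (v ! length u)) v) = x"
  proof (intro ballI ext)
    fix x v assume x: "x \<in> labelings V q (Suc k) u"
    show "(\<lambda>v\<in>rel_level V (Suc k) u.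
      split_labeling V r k u x (fst (v ! length u)) (snd (v ! length u)) v) v = x v"
    proof (cases "v \<in> rel_level V (Suc k) u")
      case True
      then obtain e i where "e \<in> down_edges V u" "i < r - 1" "v \<in> rel_level V k (u @ [(e, i)])"
        by (rule child_level_cases[OF T])
      then show ?thesis using in_child_level[of v V k u e i] by (simp add: split_labeling_def)
    next
      case False
      then show ?thesis using x by (auto simp: PiE_iff extensional_def)
    qed
  qed
  show "\<forall>h\<in>PiE (down_edges V u) (edge_labelings V r q k u). split_labeling V r k u
     (\<lambda>v\<in>rel_level V (Suc k) u. h (fst (v ! length u)) (snd (v ! length u)) v) = h"
  proof (intro ballI ext)
    fix h e i v assume h: "h \<in> PiE (down_edges V u) (edge_labelings V r q k u)"
    show "split_labeling V r k u (\<lambda>v\<in>rel_level V (Suc k) u. h (fst (v ! length u)) (snd (v ! length u)) v) e i v = h e i v"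
    proof (cases "e \<in> down_edges V u")
      case e: True
      then have he: "h e \<in> edge_labelings V r q k u e" using h by (auto simp: PiE_iff)
      show ?thesis
      proof (cases "i < r - 1")
        case i: True
        then have "h e i \<in> labelings V q k (u @ [(e, i)])" using he by (auto simp: PiE_iff)
        then show ?thesis using e i in_child_level[of v V k u e i]
          by (auto simp: split_labeling_def PiE_iff extensional_def restrict_def)
      next
        case False
        then show ?thesis using e he by (auto simp: split_labeling_def PiE_iff extensional_def)
      qed
    next
      case False
      then show ?thesis using h by (auto simp: split_labeling_def PiE_iff extensional_def)
    qed
  qed
  show "split_labeling V r k u ` labelings V q (Suc k) u \<subseteq> PiE (down_edges V u) (edge_labelings V r q k u)"
  proof (intro image_subsetI)
    fix x assume "x \<in> labelings V q (Suc k) u"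
    then have "x v < q" if "v \<in> rel_level V (Suc k) u" for v using that by (auto simp: PiE_iff)
    then show "split_labeling V r k u x \<in> PiE (down_edges V u) (edge_labelings V r q k u)"
      unfolding split_labeling_def using in_child_level(1) by (intro restrict_PiE_iff[THEN iffD2] ballI) auto
  qed
  show "(\<lambda>h. \<lambda>v\<in>rel_level V (Suc k) u. h (fst (v ! length u)) (snd (v ! length u)) v) `
     PiE (down_edges V u) (edge_labelings V r q k u) \<subseteq> labelings V q (Suc k) u"
  proof (intro image_subsetI restrict_PiE_iff[THEN iffD2] ballI)
    fix h v assume h: "h \<in> PiE (down_edges V u) (edge_labelings V r q k u)" and "v \<in> rel_level V (Suc k) u"
    then obtain e i where ei: "e \<in> down_edges V u" "i < r - 1" "v \<in> rel_level V k (u @ [(e, i)])"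
      using child_level_cases[OF T] by blast
    then have "h e i \<in> labelings V q k (u @ [(e, i)])" using h by (auto simp: PiE_iff)
    then show "h (fst (v ! length u)) (snd (v ! length u)) v \<in> {0..<q}"
      using ei(3) in_child_level(2)[OF ei(3)] by (auto simp: PiE_iff)
  qed
qed

text \<open>Conditional independence of the hyperedges: the recursion evaluates all factors on one
  common labeling, and splitting gives each factor its own coordinate.\<close>

lemma lawbelow_Suc_eq_prodW:
  assumes T: "hypertree r V" and u: "u \<in> V"
  shows "lawbelow V r q B (Suc k) u a x =
    prodW (down_edges V u) (edge_law V r q B k u) a (split_labeling V r k u x)"
proof -
  have "lawbelow V r q B k (u @ [(e, i)]) b x =
      lawbelow V r q B k (u @ [(e, i)]) b (restrict x (rel_level V k (u @ [(e, i)])))"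
    if "e \<in> down_edges V u" "i < r - 1" for e i b
    using child_in[OF T that] by (intro lawbelow_cong[OF T]) auto
  then show ?thesis by (simp add: prodW_def compW_def split_labeling_def)
qed

text \<open>Depth zero is the noiseless channel; deeper levels inherit normalisation through the
  splitting.\<close>

lemma fchan_lawbelow:
  assumes T: "hypertree r V" "2 \<le> r" and B: "fchan q (cfgs r q) B" and "u \<in> V"
  shows "fchan q (labelings V q k u) (lawbelow V r q B k u)"
  using assms(4)
proof (induction k arbitrary: u)
  case 0
  have "(\<Sum>x\<in>PiE {u} (\<lambda>_. {0..<q}). if x u = a then 1 else (0::real)) = 1" if "a < q" for a
    using sum_prod_channels[of "{u}" "\<lambda>_. {0..<q}" "\<lambda>_ y. if y = a then 1 else 0"] that by simp
  then show ?case using 0 by (auto simp: fchan_def rel_level_0 intro: finite_PiE)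
next
  case (Suc k)
  have "fchan q (PiE (down_edges V u) (edge_labelings V r q k u)) (prodW (down_edges V u) (edge_law V r q B k u))"
    using Suc.IH child_in[OF T(1)]
    by (intro fchan_prodW hypertreeD(5)[OF T(1) Suc.prems] fchan_compW B) auto
  then show ?case
    by (rule fchan_reindex[where g="split_labeling V r k u", rotated 2])
       (use bij_betw_split_labeling[OF T] lawbelow_Suc_eq_prodW[OF T(1) Suc.prems] in \<open>simp_all del: lawbelow.simps\<close>)
qed

lemma fchan_edge_law:
  assumes T: "hypertree r V" "2 \<le> r" and B: "fchan q (cfgs r q) B" and "e \<in> down_edges V u"
  shows "fchan q (edge_labelings V r q k u e) (edge_law V r q B k u e)"
  using child_in[OF T(1) assms(4)] by (intro fchan_compW[OF B] fchan_lawbelow[OF T B])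

lemma dinfo_lawbelow_Suc_le:
  assumes P: "prior q \<pi>" and f1: "f 1 = 0"
    and T: "hypertree r V" "2 \<le> r" and B: "fchan q (cfgs r q) B" and u: "u \<in> V"
    and Q: "\<And>e. e \<in> down_edges V u \<Longrightarrow> Q (edge_labelings V r q k u e) (edge_law V r q B k u e)"
    and two: "\<And>(Z :: (nat \<Rightarrow> nat \<Rightarrow> vtx \<Rightarrow> nat) set) U (Z' :: (nat \<Rightarrow> vtx \<Rightarrow> nat) set) U'.
      fchan q Z U \<Longrightarrow> fchan q Z' U' \<Longrightarrow> Q Z' U' \<Longrightarrow>
      dinfo f q \<pi> (Z \<times> Z') (tensor U U') \<le> dinfo f q \<pi> Z U + dinfo f q \<pi> Z' U'"
  shows "dinfo f q \<pi> (labelings V q (Suc k) u) (lawbelow V r q B (Suc k) u) \<le>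
    (\<Sum>e\<in>down_edges V u. dinfo f q \<pi> (edge_labelings V r q k u e) (edge_law V r q B k u e))"
proof -
  have "dinfo f q \<pi> (labelings V q (Suc k) u) (lawbelow V r q B (Suc k) u) =
     dinfo f q \<pi> (PiE (down_edges V u) (edge_labelings V r q k u)) (prodW (down_edges V u) (edge_law V r q B k u))"
    by (rule dinfo_reindex[where g="split_labeling V r k u"])
       (use bij_betw_split_labeling[OF T] lawbelow_Suc_eq_prodW[OF T(1) u] in \<open>simp_all del: lawbelow.simps\<close>)
  also have "\<dots> \<le> (\<Sum>e\<in>down_edges V u. dinfo f q \<pi> (edge_labelings V r q k u e) (edge_law V r q B k u e))"
    by (rule dinfo_prodW_le[where Q=Q, OF P, of f, OF f1 hypertreeD(5)[OF T(1) u] fchan_edge_law[OF T B] Q two])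
  finally show ?thesis .
qed

section \<open>A criterion for the impossibility of reconstruction\<close>

text \<open>The factor \<open>\<pi> a\<close> cancels inside the logarithm and leaves the likelihood
  ratio against the mixture.\<close>

lemma mutual_info_level_eq_dinfo:
  assumes P: "prior q \<pi>" and T: "hypertree r V" "2 \<le> r" and B: "fchan q (cfgs r q) B"
  shows "ennreal (mutual_info_level V r q \<pi> B k) = dinfo f_KL q \<pi> (labelings V q k []) (lawbelow V r q B k [])"
    and "0 \<le> mutual_info_level V r q \<pi> B k"
proof -
  let ?W = "lawbelow V r q B k []"
  note F = fchan_lawbelow[OF T B hypertreeD(1)[OF T(1)], of k]
  have "mutual_info_level V r q \<pi> B k =
    (\<Sum>a<q. \<pi> a * (\<Sum>x\<in>labelings V q k []. ?W a x * ln (?W a x / mix q \<pi> ?W x)))"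
    unfolding mutual_info_level_def rel_level_Nil
  proof (rule sum.cong[OF refl], subst sum_distrib_left, rule sum.cong[OF refl])
    fix a x assume "a \<in> {..<q}"
    then have "\<pi> a \<noteq> 0" using priorD(1)[OF P, of a] by auto
    then show "joint V r q \<pi> B k a x * ln (joint V r q \<pi> B k a x / (\<pi> a * (\<Sum>b<q. joint V r q \<pi> B k b x))) =
      \<pi> a * (?W a x * ln (?W a x / mix q \<pi> ?W x))"
      by (simp add: joint_def mix_def)
  qed
  then show "ennreal (mutual_info_level V r q \<pi> B k) = dinfo f_KL q \<pi> (labelings V q k []) ?W"
    "0 \<le> mutual_info_level V r q \<pi> B k"
    using dinfo_KL[OF P F] by simp_all
qed

text \<open>Common frame of all five cases. The bound is asked from depth one on, because at depth
  zero the label itself is seen and SKL information is infinite as soon as there are two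
  labels.\<close>

lemma recon_impossible_criterion:
  assumes P: "prior q \<pi>" and T: "hypertree r V" "2 \<le> r" and B: "fchan q (cfgs r q) B"
    and f: "\<And>t. 0 \<le> t \<Longrightarrow> f_KL t \<le> f t"
    and vertex: "\<And>k u. u \<in> V \<Longrightarrow> dinfo f q \<pi> (labelings V q (Suc k) u) (lawbelow V r q B (Suc k) u) \<le>
      (\<Sum>e\<in>down_edges V u. dinfo f q \<pi> (edge_labelings V r q k u e) (edge_law V r q B k u e))"
    and edge: "\<And>k u e. e \<in> down_edges V u \<Longrightarrow>
      (\<Sum>i<r-1. dinfo f q \<pi> (labelings V q k (u @ [(e, i)])) (lawbelow V r q B k (u @ [(e, i)]))) < \<infinity> \<Longrightarrow>
      dinfo f q \<pi> (edge_labelings V r q k u e) (edge_law V r q B k u e) \<le>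
      \<eta> * (\<Sum>i<r-1. dinfo f q \<pi> (labelings V q k (u @ [(e, i)])) (lawbelow V r q B k (u @ [(e, i)])))"
    and bound: "\<And>k u. u \<in> V \<Longrightarrow> dinfo f q \<pi> (labelings V q (Suc k) u) (lawbelow V r q B (Suc k) u) \<le> ennreal C" "0 \<le> C"
    and br: "br V * \<eta> < 1"
  shows "recon_impossible V r q \<pi> B"
proof -
  \<comment> \<open>Shifted index: \<open>J 0\<close> is already the information at depth
    one.\<close>
  define J where "J k u = dinfo f q \<pi> (labelings V q (Suc k) u) (lawbelow V r q B (Suc k) u)" for k u
  have lim: "(\<lambda>k. J k []) \<longlonglongrightarrow> 0"
  proof (rule subharmonic_tendsto_0[OF T _ bound(2) _ br])
    show "J k u \<le> ennreal C" if "u \<in> V" for k u using bound(1)[OF that] by (simp only: J_def)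
    fix k u assume u: "u \<in> V"
    have "J (Suc k) u \<le> (\<Sum>e\<in>down_edges V u. \<eta> * (\<Sum>i<r-1. J k (u @ [(e, i)])))"
      unfolding J_def
    proof (rule order_trans[OF vertex[OF u]], intro sum_mono edge)
      fix e assume e: "e \<in> down_edges V u"
      \<comment> \<open>\<open>edge\<close> applies only to finite sums of informations, and the
        uniform bound provides finiteness.\<close>
      have "J k (u @ [(e, i)]) < \<top>" if "i < r - 1" for i
        using bound(1)[OF child_in[OF T(1) e that], of k] unfolding J_def
        by (rule order_le_less_trans) simp
      then show "(\<Sum>i<r-1. dinfo f q \<pi> (labelings V q (Suc k) (u @ [(e, i)])) (lawbelow V r q B (Suc k) (u @ [(e, i)]))) < \<infinity>"
        unfolding J_def by (simp del: lawbelow.simps)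
    qed
    then show "J (Suc k) u \<le> \<eta> * (\<Sum>v\<in>children V u. J k v)"
      by (simp add: sum_children[OF T] sum_distrib_left)
  qed
  have le: "ennreal (mutual_info_level V r q \<pi> B (Suc k)) \<le> J k []" for k
    unfolding mutual_info_level_eq_dinfo(1)[OF P T B] J_def
    by (intro dinfo_mono[OF P fchan_lawbelow[OF T B hypertreeD(1)[OF T(1)]]] f)
  have "(\<lambda>k. ennreal (mutual_info_level V r q \<pi> B (Suc k))) \<longlonglongrightarrow> 0"
    by (rule tendsto_sandwich[OF _ _ tendsto_const lim]) (simp_all only: le zero_le eventually_True)
  then have "(\<lambda>k. mutual_info_level V r q \<pi> B (Suc k)) \<longlonglongrightarrow> 0"
    using mutual_info_level_eq_dinfo(2)[OF P T B] by (subst (asm) ennreal_tendsto_0_iff) auto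
  then show ?thesis unfolding recon_impossible_def by (subst (asm) filterlim_sequentially_Suc)
qed

section \<open>Bounds uniform in vertex and depth\<close>

text \<open>The mixture contains the term \<open>\<pi> a * W a y\<close>, so likelihood ratios are
  at most \<open>1 / \<pi> a\<close>; the sum of the reciprocals bounds them for all labels at once,
  and the \<open>+ 1\<close> accommodates the shift in \<open>t - 1\<close>.\<close>

lemma dinfo_chi2_bounded:
  assumes P: "prior q \<pi>" and W: "fchan q Y W"
  shows "dinfo f_chi2 q \<pi> Y W \<le> ennreal (((\<Sum>a<q. 1 / \<pi> a) + 1)^2)"
proof (rule dinfo_le_const[OF P W])
  let ?K = "\<Sum>a<q. 1 / \<pi> a"
  fix a y assume a: "a < q" and y: "y \<in> Y" and m: "0 < mix q \<pi> W y"
  have "W a y / mix q \<pi> W y \<le> 1 / \<pi> a"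
    using mix_ge[OF P W y a] m priorD(1)[OF P a] by (simp add: field_simps)
  also have "\<dots> \<le> ?K" using priorD(2)[OF P] a by (intro member_le_sum) auto
  finally have "W a y / mix q \<pi> W y \<le> ?K" .
  moreover have "0 \<le> W a y / mix q \<pi> W y" using fchanD(2)[OF W a y] m by simp
  ultimately have "\<bar>W a y / mix q \<pi> W y - 1\<bar> \<le> \<bar>?K + 1\<bar>" by linarith
  then show "f_chi2 (W a y / mix q \<pi> W y) \<le> ennreal ((?K + 1)^2)"
    unfolding f_chi2_def by (intro ennreal_leI) (simp only: abs_le_square_iff)
qed simp

text \<open>Finite SKL information means equal supports, and finitely many finite ratios are
  bounded.\<close>

lemma bounded_ratio_of_SKL_finite:
  assumes P: "prior q \<pi>" and W: "fchan q Y W" and fin: "dinfo f_SKL q \<pi> Y W < \<infinity>"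
  obtains c :: real where "1 \<le> c" "\<And>a b y. a < q \<Longrightarrow> b < q \<Longrightarrow> y \<in> Y \<Longrightarrow> W a y \<le> c * W b y"
proof
  let ?R = "\<lambda>a b y. W a y / W b y"
  \<comment> \<open>The sum is a crude maximum; the \<open>1 +\<close> makes the logarithm of the
    constant nonnegative.\<close>
  let ?c = "1 + (\<Sum>a<q. \<Sum>b<q. \<Sum>y\<in>Y. ?R a b y)"
  have R0: "0 \<le> ?R a b y" if "a < q" "b < q" "y \<in> Y" for a b y
    using fchanD(2)[OF W] that by simp
  have "0 \<le> (\<Sum>a<q. \<Sum>b<q. \<Sum>y\<in>Y. ?R a b y)" by (intro sum_nonneg R0) auto
  then show "1 \<le> ?c" by simp
  fix a b y assume *: "a < q" "b < q" "y \<in> Y"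
  show "W a y \<le> ?c * W b y"
  proof (cases "mix q \<pi> W y = 0")
    case True
    then show ?thesis using mix_zero_iff[OF P W *(3)] * by simp
  next
    case False
    then have b: "0 < W b y" using mix_nonneg[OF P W *(3)] fin * dinfo_SKL_finite_iff[OF P W] by (auto simp: less_le)
    have "?R a b y \<le> (\<Sum>y\<in>Y. ?R a b y)"
      using * R0 fchanD(1)[OF W] by (intro member_le_sum) auto
    also have "\<dots> \<le> (\<Sum>b<q. \<Sum>y\<in>Y. ?R a b y)"
      using * R0 by (intro member_le_sum[of b "{..<q}" "\<lambda>b. \<Sum>y\<in>Y. ?R a b y"]) (auto intro!: sum_nonneg)
    also have "\<dots> \<le> (\<Sum>a<q. \<Sum>b<q. \<Sum>y\<in>Y. ?R a b y)"
      using * R0 by (intro member_le_sum[of a "{..<q}" "\<lambda>a. \<Sum>b<q. \<Sum>y\<in>Y. ?R a b y"]) (auto intro!: sum_nonneg)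
    finally have "?R a b y \<le> ?c" by simp
    then show ?thesis using b by (simp add: pos_divide_le_eq)
  qed
qed

text \<open>For \<open>t < 1\<close> the product equals \<open>(1 - t) * ln (1 / t)\<close>, so
  \<open>1 / t\<close> takes over the role of \<open>t\<close>.\<close>

lemma x_minus_1_ln_le:
  fixes t c :: real
  assumes "0 < t" "t \<le> c" "1 / t \<le> c"
  shows "(t - 1) * ln t \<le> c * ln c"
proof (cases "1 \<le> t")
  case True
  then show ?thesis using assms by (intro mult_mono) auto
next
  case False
  then have i: "1 \<le> 1 / t" using assms(1) by simp
  have "ln (1 / t) = - ln t" using assms(1) by (metis inverse_eq_divide ln_inverse)
  then have "(t - 1) * ln t = (1 - t) * ln (1 / t)" by (metis minus_diff_eq minus_mult_minus)
  also have "\<dots> \<le> c * ln c"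
  proof (rule mult_mono)
    show "1 - t \<le> c" "0 \<le> c" using assms i by linarith+
    show "ln (1 / t) \<le> ln c" using assms(3) i by (intro ln_mono) linarith+
    show "0 \<le> ln (1 / t)" using i by (rule ln_ge_zero)
  qed
  finally show ?thesis .
qed

text \<open>Averaging the ratio bound over the prior compares each row with the mixture in both
  directions, as \<open>x_minus_1_ln_le\<close> requires.\<close>

lemma dinfo_SKL_le_of_bounded_ratio:
  assumes P: "prior q \<pi>" and W: "fchan q Y W" and c: "1 \<le> c"
    and ratio: "\<And>a b y. a < q \<Longrightarrow> b < q \<Longrightarrow> y \<in> Y \<Longrightarrow> W a y \<le> c * W b y"
  shows "dinfo f_SKL q \<pi> Y W \<le> ennreal (c * ln c)"
proof (rule dinfo_le_const[OF P W])
  fix a y assume a: "a < q" and y: "y \<in> Y" and m: "0 < mix q \<pi> W y"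
  let ?t = "W a y / mix q \<pi> W y"
  have const: "(\<Sum>b<q. \<pi> b * z) = z" for z using priorD(3)[OF P] by (simp flip: sum_distrib_right)
  have "W a y \<le> c * mix q \<pi> W y"
  proof -
    have "(\<Sum>b<q. \<pi> b * W a y) \<le> (\<Sum>b<q. \<pi> b * (c * W b y))"
      using ratio a y priorD(2)[OF P] by (intro sum_mono mult_left_mono) auto
    then show ?thesis unfolding const by (simp add: mix_def sum_distrib_left mult_ac)
  qed
  moreover have "mix q \<pi> W y \<le> c * W a y"
  proof -
    have "mix q \<pi> W y \<le> (\<Sum>b<q. \<pi> b * (c * W a y))"
      unfolding mix_def using ratio a y priorD(2)[OF P] by (intro sum_mono mult_left_mono) auto
    then show ?thesis unfolding const .
  qed
  moreover from this m have "0 < W a y" using c by (smt (verit) mult_nonneg_nonpos)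
  ultimately have t: "0 < ?t" "?t \<le> c" "1 / ?t \<le> c" using m by (simp_all add: field_simps)
  have "(?t - 1) * ln ?t \<le> c * ln c" by (rule x_minus_1_ln_le[OF t])
  then show "f_SKL ?t \<le> ennreal (c * ln c)"
    using less_imp_neq[OF t(1), symmetric] by (simp only: f_SKL_def if_False ennreal_leI)
qed (use c in simp)

text \<open>An edge law is a mixture of child laws with weights \<open>B a x\<close>. Replacing
  \<open>a\<close> by \<open>b\<close> changes the weights by a factor of at most \<open>c\<close>,
  whatever the depth, so each hyperedge contributes at most \<open>c * ln c\<close>; subadditivity
  multiplies this by the number of hyperedges.\<close>

lemma dinfo_lawbelow_SKL_bounded:
  assumes P: "prior q \<pi>" and T: "hypertree r V" "2 \<le> r" and B: "fchan q (cfgs r q) B"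
    and fin: "dinfo f_SKL q \<pi> (cfgs r q) B < \<infinity>" and D: "bounded_down_degree V"
    and vertex: "\<And>k u. u \<in> V \<Longrightarrow> dinfo f_SKL q \<pi> (labelings V q (Suc k) u) (lawbelow V r q B (Suc k) u) \<le>
      (\<Sum>e\<in>down_edges V u. dinfo f_SKL q \<pi> (edge_labelings V r q k u e) (edge_law V r q B k u e))"
  obtains C :: real where "0 \<le> C"
    "\<And>k u. u \<in> V \<Longrightarrow> dinfo f_SKL q \<pi> (labelings V q (Suc k) u) (lawbelow V r q B (Suc k) u) \<le> ennreal C"
proof -
  obtain c where c: "1 \<le> c" "\<And>a b x. a < q \<Longrightarrow> b < q \<Longrightarrow> x \<in> cfgs r q \<Longrightarrow> B a x \<le> c * B b x"
    using bounded_ratio_of_SKL_finite[OF P B fin] by blast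
  obtain N where N: "\<And>u. u \<in> V \<Longrightarrow> card (down_edges V u) \<le> N"
    using D by (auto simp: bounded_down_degree_def)
  have cc: "0 \<le> c * ln c" using c(1) by simp
  have edge: "dinfo f_SKL q \<pi> (edge_labelings V r q k u e) (edge_law V r q B k u e) \<le> ennreal (c * ln c)"
    if e: "e \<in> down_edges V u" for k u e
  proof (rule dinfo_SKL_le_of_bounded_ratio[OF P fchan_edge_law[OF T B e] c(1)])
    fix a b h assume ab: "a < q" "b < q" and h: "h \<in> edge_labelings V r q k u e"
    have "0 \<le> lawbelow V r q B k (u @ [(e, i)]) (x i) (h i)" if "x \<in> cfgs r q" "i < r - 1" for x i
      using fchanD(2)[OF fchan_lawbelow[OF T B child_in[OF T(1) e that(2)]] cfgs_less[OF that]] h that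
      by (auto simp: PiE_iff)
    then have "edge_law V r q B k u e a h \<le> (\<Sum>x\<in>cfgs r q. c * B b x * (\<Prod>i<r-1. lawbelow V r q B k (u @ [(e, i)]) (x i) (h i)))"
      unfolding compW_def using c(2) ab by (intro sum_mono mult_right_mono prod_nonneg) auto
    then show "edge_law V r q B k u e a h \<le> c * edge_law V r q B k u e b h"
      unfolding compW_def by (simp add: sum_distrib_left mult.assoc)
  qed
  show thesis
  proof (rule that[of "of_nat N * (c * ln c)"])
    show "0 \<le> real N * (c * ln c)" using cc by simp
    fix k u assume u: "u \<in> V"
    have "dinfo f_SKL q \<pi> (labelings V q (Suc k) u) (lawbelow V r q B (Suc k) u) \<le> (\<Sum>e\<in>down_edges V u. ennreal (c * ln c))"
      by (rule order_trans[OF vertex[OF u] sum_mono[OF edge]])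
    also have "\<dots> = of_nat (card (down_edges V u)) * ennreal (c * ln c)" by simp
    also have "\<dots> \<le> of_nat N * ennreal (c * ln c)"
      using N[OF u] by (intro mult_right_mono) auto
    also have "\<dots> = ennreal (real N * (c * ln c))"
      using cc by (simp add: ennreal_mult ennreal_of_nat_eq_real_of_nat)
    finally show "dinfo f_SKL q \<pi> (labelings V q (Suc k) u) (lawbelow V r q B (Suc k) u) \<le> \<dots>" .
  qed
qed

section \<open>Sign-flip symmetry of binary models\<close>

lemma flip_in_cfgs: "x \<in> cfgs r 2 \<Longrightarrow> flip r x \<in> cfgs r 2"
  by (auto simp: flip_def cfgs_def PiE_iff)

lemma flip_flip: "x \<in> cfgs r 2 \<Longrightarrow> flip r (flip r x) = x"
  by (auto intro!: ext diff_diff_cancel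
      simp: flip_def cfgs_def PiE_iff extensional_def restrict_def numeral_2_eq_2 less_Suc_eq_le)

text \<open>Singletons in \<open>bms_inv\<close> give the case \<open>a = 0\<close>; the case
  \<open>a = 1\<close> follows by flipping twice.\<close>

lemma binary_symmetric_flip:
  assumes "fchan 2 (cfgs r 2) B" "binary_symmetric q r \<pi> B" "x \<in> cfgs r 2" "a < 2"
  shows "B (1 - a) (flip r x) = B a x"
proof -
  have eq: "B 0 x = B 1 (flip r x)" if x: "x \<in> cfgs r 2" for x
  proof -
    have "emeasure (Bmeas 2 r B 0) {x} = emeasure (Bmeas 2 r B 1) (flip r ` {x})"
      using assms(2) x unfolding binary_symmetric_def bms_inv_def by (auto simp: Bmeas_def sets_point_measure)
    then have "ennreal (B 0 x) = ennreal (B 1 (flip r x))"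
      using x flip_in_cfgs[OF x] by (simp add: Bmeas_def emeasure_point_measure_finite finite_cfgs)
    then show ?thesis
      using fchanD(2)[OF assms(1) _ x, of 0] fchanD(2)[OF assms(1) _ flip_in_cfgs[OF x], of 1] by simp
  qed
  from assms(4) consider "a = 0" | "a = 1" by linarith
  then show ?thesis
    using eq[OF assms(3)] eq[OF flip_in_cfgs[OF assms(3)]] flip_flip[OF assms(3)] by cases auto
qed

text \<open>Substitute the flipped configuration in the sum. \<open>h\<close> and \<open>h'\<close>
  are linked only coordinate by coordinate, so the lemma serves both a labeling of the whole level
  and a tuple of separate outputs.\<close>

lemma compW_flip:
  assumes B: "\<And>x. x \<in> cfgs r 2 \<Longrightarrow> B (1 - a) (flip r x) = B a x"
    and W: "\<And>i b. i < r - 1 \<Longrightarrow> b < 2 \<Longrightarrow> W i b (h i) = W i (1 - b) (h' i)"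
  shows "compW r 2 B W a h = compW r 2 B W (1 - a) h'"
proof -
  have bij: "bij_betw (flip r) (cfgs r 2) (cfgs r 2)"
    by (rule bij_betw_byWitness[where f'="flip r"]) (auto simp: flip_flip flip_in_cfgs)
  have "compW r 2 B W (1 - a) h' =
    (\<Sum>x\<in>cfgs r 2. B (1 - a) (flip r x) * (\<Prod>i<r-1. W i (flip r x i) (h' i)))"
    unfolding compW_def by (rule sum.reindex_bij_betw[OF bij, symmetric])
  also have "\<dots> = compW r 2 B W a h"
    unfolding compW_def
    by (intro sum.cong arg_cong2[where f="(*)"] prod.cong refl B)
       (auto simp: flip_def W[OF _ cfgs_less])
  finally show ?thesis by simp
qed

lemma lawbelow_flip:
  assumes T: "hypertree r V" and B: "\<And>x a. x \<in> cfgs r 2 \<Longrightarrow> a < 2 \<Longrightarrow> B (1 - a) (flip r x) = B a x"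
    and "u \<in> V" "\<And>v. v \<in> rel_level V k u \<Longrightarrow> x v < 2" "a < 2"
  shows "lawbelow V r 2 B k u a x = lawbelow V r 2 B k u (1 - a) (\<lambda>v. 1 - x v)"
  using assms(3-)
proof (induction k arbitrary: u a)
  case 0
  then show ?case by (auto simp: rel_level_0 less_2_cases_iff)
next
  case (Suc k)
  \<comment> \<open>The constant family \<open>\<lambda>_. x\<close> lets \<open>compW\<close> read
    the unsplit labeling in every coordinate.\<close>
  have "compW r 2 B (\<lambda>i. lawbelow V r 2 B k (u @ [(e, i)])) a (\<lambda>_. x) =
      compW r 2 B (\<lambda>i. lawbelow V r 2 B k (u @ [(e, i)])) (1 - a) (\<lambda>_ v. 1 - x v)"
    if "e \<in> down_edges V u" for e
    using that Suc.prems
    by (intro compW_flip B Suc.IH child_in[OF T]) (auto dest: in_child_level(1))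
  then show ?case by (simp add: compW_def)
qed

lemma symch_lawbelow:
  assumes T: "hypertree r V" and B: "\<And>x a. x \<in> cfgs r 2 \<Longrightarrow> a < 2 \<Longrightarrow> B (1 - a) (flip r x) = B a x"
    and u: "u \<in> V"
  shows "symch (labelings V 2 k u) (lawbelow V r 2 B k u)"
  unfolding symch_def
proof (intro exI ballI conjI)
  \<comment> \<open>The restriction keeps the flipped labeling extensional.\<close>
  let ?s = "\<lambda>x. \<lambda>v\<in>rel_level V k u. 1 - x v"
  fix x assume x: "x \<in> labelings V 2 k u"
  show "?s x \<in> labelings V 2 k u" by auto
  show "?s (?s x) = x"
    using x by (auto intro!: ext diff_diff_cancel simp: PiE_iff extensional_def restrict_def numeral_2_eq_2 less_Suc_eq_le)
  have "lawbelow V r 2 B k u 0 x = lawbelow V r 2 B k u 1 (\<lambda>v. 1 - x v)"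
    using lawbelow_flip[where B=B, OF T B u, of k x 0] x by (auto simp: PiE_iff)
  also have "\<dots> = lawbelow V r 2 B k u 1 (?s x)" by (intro lawbelow_cong[OF T u]) auto
  finally show "lawbelow V r 2 B k u 0 x = lawbelow V r 2 B k u 1 (?s x)" .
qed

text \<open>The involutions of the factors act coordinatewise, and the flip of the hidden
  configuration compensates them.\<close>

lemma symch_compW:
  assumes B: "\<And>x a. x \<in> cfgs r 2 \<Longrightarrow> a < 2 \<Longrightarrow> B (1 - a) (flip r x) = B a x"
    and W: "\<And>i. i < r - 1 \<Longrightarrow> symch (Y i) (W i)"
  shows "symch (PiE {0..<r-1} Y) (compW r 2 B W)"
proof -
  obtain s where s: "\<And>i y. i < r - 1 \<Longrightarrow> y \<in> Y i \<Longrightarrow> s i y \<in> Y i \<and> s i (s i y) = y \<and> W i 0 y = W i 1 (s i y)"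
    using W unfolding symch_def by metis
  show ?thesis unfolding symch_def
  proof (intro exI ballI conjI)
    let ?s = "\<lambda>h. \<lambda>i\<in>{0..<r-1}. s i (h i)"
    fix h assume h: "h \<in> PiE {0..<r-1} Y"
    then have hi: "h i \<in> Y i" if "i < r - 1" for i using that by (auto simp: PiE_iff)
    show "?s h \<in> PiE {0..<r-1} Y" using s hi by auto
    show "?s (?s h) = h" using s hi h by (auto intro!: ext simp: PiE_iff extensional_def restrict_def)
    have "W i b (h i) = W i (1 - b) (?s h i)" if "i < r - 1" "b < 2" for i b
      using s[OF that(1) hi[OF that(1)]] s[of i "s i (h i)"] that by (auto simp: less_2_cases_iff)
    then have "compW r 2 B W 0 h = compW r 2 B W (1 - 0) (?s h)"
      by (intro compW_flip B) auto
    then show "compW r 2 B W 0 h = compW r 2 B W 1 (?s h)" by simp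
  qed
qed

lemma f_KL_1: "f_KL 1 = 0" and f_chi2_1: "f_chi2 1 = 0" and f_SKL_1: "f_SKL 1 = 0"
  by (simp_all add: f_KL_def f_chi2_def f_SKL_def)

theorem mainTheorem8:
  fixes q r :: nat and \<pi> :: "nat \<Rightarrow> real" and B :: "nat \<Rightarrow> (nat \<Rightarrow> nat) \<Rightarrow> real"
    and V :: "vtx set"
  assumes "boht_params q r \<pi> B" and "hypertree r V"
  shows "((br V * eta_ht f_KL q r \<pi> B < 1 \<or>
           (br V * eta_ht f_SKL q r \<pi> B < 1 \<and> f_info f_SKL q \<pi> (Bmeas q r B) < \<infinity> \<and>
            bounded_down_degree V))
          \<longrightarrow> recon_impossible V r q \<pi> B) \<and>
         (binary_symmetric q r \<pi> B \<longrightarrow>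
          (br V * eta_hts f_KL r B < 1 \<or> br V * eta_hts f_chi2 r B < 1 \<or>
           (br V * eta_hts f_SKL r B < 1 \<and> C_f f_SKL (Bmeas 2 r B) < \<infinity> \<and>
            bounded_down_degree V))
          \<longrightarrow> recon_impossible V r q \<pi> B)"
proof -
  note P = boht_paramsD(1)[OF assms(1)] and B = boht_paramsD(2)[OF assms(1)]
  have T: "hypertree r V" "2 \<le> r" using assms by (auto simp: boht_params_def)
  note F = fchan_lawbelow[OF T B]
  let ?I = "\<lambda>f k u. dinfo f q \<pi> (labelings V q k u) (lawbelow V r q B k u)"
  let ?E = "\<lambda>f k u e. dinfo f q \<pi> (edge_labelings V r q k u e) (edge_law V r q B k u e)"
  let ?K = "((\<Sum>a<q. 1 / \<pi> a) + 1)^2"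
  have vertex_KL: "?I f_KL (Suc k) u \<le> (\<Sum>e\<in>down_edges V u. ?E f_KL k u e)" if "u \<in> V" for k u
    by (rule dinfo_lawbelow_Suc_le[where Q="\<lambda>_ _. True", OF P _ T B that])
       (simp_all add: f_KL_1 dinfo_KL_tensor[OF P])
  have vertex_SKL: "?I f_SKL (Suc k) u \<le> (\<Sum>e\<in>down_edges V u. ?E f_SKL k u e)" if "u \<in> V" for k u
    by (rule dinfo_lawbelow_Suc_le[where Q="\<lambda>_ _. True", OF P _ T B that])
       (simp_all add: f_SKL_1 dinfo_SKL_tensor[OF P])
  have bound_chi2: "?I f_chi2 k u \<le> ennreal ?K" if "u \<in> V" for k u
    by (rule dinfo_chi2_bounded[OF P F[OF that]])
  \<comment> \<open>Inherited from chi-squared, so one constant serves both informations.\<close>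
  have bound_KL: "?I f_KL k u \<le> ennreal ?K" if "u \<in> V" for k u
    by (rule order_trans[OF dinfo_mono[OF P F[OF that] f_KL_le_f_chi2] bound_chi2[OF that]])
  note ht = dinfo_compW_le_eta_ht[OF P B F[OF child_in[OF T(1)]]]
  have Bmeas: "f_info f q \<pi> (Bmeas q r B) = dinfo f q \<pi> (cfgs r q) B" for f
    unfolding Bmeas_def by (rule f_info_point_measure[OF P B])
  have KL: "recon_impossible V r q \<pi> B" if "br V * eta_ht f_KL q r \<pi> B < 1"
    by (rule recon_impossible_criterion[OF P T B order_refl vertex_KL ht bound_KL _ that])
       (simp_all add: f_KL_1)
  have SKL: "recon_impossible V r q \<pi> B"
    if br: "br V * eta_ht f_SKL q r \<pi> B < 1" and fin: "f_info f_SKL q \<pi> (Bmeas q r B) < \<infinity>" and D: "bounded_down_degree V"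
  proof -
    obtain C where C: "0 \<le> C" "\<And>k u. u \<in> V \<Longrightarrow> ?I f_SKL (Suc k) u \<le> ennreal C"
      using dinfo_lawbelow_SKL_bounded[OF P T B fin[unfolded Bmeas] D vertex_SKL] by blast
    show ?thesis
      by (rule recon_impossible_criterion[OF P T B f_KL_le_f_SKL vertex_SKL ht C(2) C(1) br])
         (simp_all add: f_SKL_1 f_KL_le_f_SKL)
  qed
  have sym: "recon_impossible V r q \<pi> B"
    if S: "binary_symmetric q r \<pi> B" and C: "br V * eta_hts f_KL r B < 1 \<or> br V * eta_hts f_chi2 r B < 1 \<or>
           (br V * eta_hts f_SKL r B < 1 \<and> C_f f_SKL (Bmeas 2 r B) < \<infinity> \<and> bounded_down_degree V)"
  proof -
    have q: "q = 2" and h: "\<pi> 0 = 1/2" "\<pi> 1 = 1/2" using S by (auto simp: binary_symmetric_def)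
    note P2 = P[unfolded q] and B2 = B[unfolded q] and F2 = F[unfolded q]
    note flip = binary_symmetric_flip[OF B2 S]
    have symV: "symch (labelings V 2 k u) (lawbelow V r 2 B k u)" if "u \<in> V" for k u
      by (intro symch_lawbelow[OF T(1)] flip that)
    have symE: "symch (edge_labelings V r 2 k u e) (edge_law V r 2 B k u e)" if "e \<in> down_edges V u" for k u e
      using child_in[OF T(1) that] by (intro symch_compW flip symV) auto
    \<comment> \<open>For chi-squared symmetry enters twice: \<open>symE\<close> gives subadditivity
      at a vertex, \<open>symV\<close> the comparison with the symmetric coefficient.\<close>
    have vertex_chi2: "?I f_chi2 (Suc k) u \<le> (\<Sum>e\<in>down_edges V u. ?E f_chi2 k u e)" if "u \<in> V" for k u
      unfolding q
      by (rule dinfo_lawbelow_Suc_le[where Q=symch, OF P2 _ T B2 that])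
         (rule f_chi2_1 symE dinfo_chi2_tensor[OF P2 h] | assumption)+
    note hts = dinfo_compW_le_eta_hts[OF P2 h B2 F2[OF child_in[OF T(1)]] symV[OF child_in[OF T(1)]], folded q]
    show ?thesis using C
    proof (elim disjE conjE)
      assume "br V * eta_hts f_KL r B < 1"
      then show ?thesis
        by (intro recon_impossible_criterion[OF P T B order_refl vertex_KL hts bound_KL])
           (simp_all add: f_KL_1)
    next
      assume "br V * eta_hts f_chi2 r B < 1"
      then show ?thesis
        by (intro recon_impossible_criterion[OF P T B f_KL_le_f_chi2 vertex_chi2 hts bound_chi2])
           (simp_all add: f_chi2_1 f_KL_le_f_chi2)
    next
      assume br: "br V * eta_hts f_SKL r B < 1" and fin: "C_f f_SKL (Bmeas 2 r B) < \<infinity>" and D: "bounded_down_degree V"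
      have "C_f f_SKL (Bmeas 2 r B) = f_info f_SKL q \<pi> (Bmeas q r B)"
        unfolding C_f_def q using h by (intro f_info_cong) (auto simp: less_2_cases_iff)
      with fin have fin': "dinfo f_SKL q \<pi> (cfgs r q) B < \<infinity>" by (simp only: Bmeas)
      obtain C where C: "0 \<le> C" "\<And>k u. u \<in> V \<Longrightarrow> ?I f_SKL (Suc k) u \<le> ennreal C"
        using dinfo_lawbelow_SKL_bounded[OF P T B fin' D vertex_SKL] by blast
      show ?thesis
        by (rule recon_impossible_criterion[OF P T B f_KL_le_f_SKL vertex_SKL hts C(2) C(1) br])
           (simp_all add: f_SKL_1 f_KL_le_f_SKL)
    qed
  qed
  show ?thesis using KL SKL sym by blast
qed

end
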